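(* Each large locally multipresentable category is weakly LS-accessible; that is, if $\mathcal{K}$ is a large locally multipresentable category, then there is a cardinal $\lambda$ such that for every regular cardinal $\lambda'\ge\lambda$, $\mathcal{K}$ contains an object of internal size exactly $\lambda'$.
   Context: For a regular cardinal $\lambda$, an object $M$ of a category $\mathcal{K}$ is $\lambda$-presentable if $\mathcal{K}(M,-)$ preserves $\lambda$-directed colimits (colimits indexed by posets in which every subset of size $<\lambda$ has an upper bound). A category is $\lambda$-accessible if it has $\lambda$-directed colimits, has only a set of $\lambda$-presentable objects up to isomorphism, and every object is a $\lambda$-directed colimit of $\lambda$-presentable objects; it is accessible if it is $\lambda$-accessible for some regular $\lambda$. A category is large if it has a proper class of pairwise non-isomorphic objects. A locally multipresentable category is an accessible category with all connected limits; equivalently, an accessible category with all multicolimits (for each small diagram $D$ there is a set of cocones over $D$ such that every cocone over $D$ admits a unique map from a unique member of that set). In an accessible category $\mathcal{K}$, the presentability rank $r_{\mathcal{K}}(M)$ is the least regular $\lambda$ such that $M$ is $\lambda$-presentable, and the internal size is $|M|_{\mathcal{K}}:=\chi$ if $r_{\mathcal{K}}(M)=\chi^+$, and $|M|_{\mathcal{K}}:=r_{\mathcal{K}}(M)$ if $r_{\mathcal{K}}(M)$ is a limit cardinal. *)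

theory Defs
  imports Main "HOL-Library.FuncSet"
begin

unbundle cardinal_syntax

text \<open>
  Size conventions.  A type \<open>'v\<close> whose cardinality is strongly inaccessible plays the role of the
  universe of sets: a class is a subset of \<open>'v\<close>, and a set is, up to bijection, a subset of \<open>'v\<close> of
  cardinality strictly less than that of \<open>'v\<close>.  Every small structure (poset, diagram shape, hom-set,
  cardinal) then has an isomorphic copy carried by a small subset of \<open>'v\<close>, so that quantifying over
  small subsets of \<open>'v\<close> is quantifying over all small structures.
\<close>

definition strongly_inaccessible :: "'a rel \<Rightarrow> bool" where
  "strongly_inaccessible r \<longleftrightarrow>
     Card_order r \<and> natLeq <o r \<and> regularCard r \<and> (\<forall>A :: 'a set. |A| <o r \<longrightarrow> |Pow A| <o r)"

definition small :: "'v set \<Rightarrow> bool" where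
  "small A \<longleftrightarrow> |A| <o |UNIV :: 'v set|"

text \<open>Cardinals are well-orders, compared by \<open>\<le>o\<close> and identified up to \<open>=o\<close>.\<close>

definition small_cardinal :: "'v rel \<Rightarrow> bool" where
  "small_cardinal r \<longleftrightarrow> Card_order r \<and> r <o |UNIV :: 'v set|"

definition small_regular :: "'v rel \<Rightarrow> bool" where
  "small_regular r \<longleftrightarrow> small_cardinal r \<and> cinfinite r \<and> regularCard r"

definition limit_cardinal :: "'v rel \<Rightarrow> bool" where
  "limit_cardinal r \<longleftrightarrow>
     Card_order r \<and> cinfinite r \<and> (\<forall>s :: 'v rel. Card_order s \<and> s <o r \<longrightarrow> cardSuc s <o r)"


record ('o, 'a) cat =
  Obj :: "'o set"
  Arr :: "'a set"
  Dom :: "'a \<Rightarrow> 'o"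
  Cod :: "'a \<Rightarrow> 'o"
  Ident :: "'o \<Rightarrow> 'a"
  Comp :: "'a \<Rightarrow> 'a \<Rightarrow> 'a"  \<comment> \<open>\<open>Comp C g f\<close> is the composite of \<open>f\<close> followed by \<open>g\<close>\<close>

definition Hom :: "('o, 'a) cat \<Rightarrow> 'o \<Rightarrow> 'o \<Rightarrow> 'a set" where
  "Hom C X Y = {f \<in> Arr C. Dom C f = X \<and> Cod C f = Y}"

definition category :: "('o, 'a) cat \<Rightarrow> bool" where
  "category C \<longleftrightarrow>
     (\<forall>f \<in> Arr C. Dom C f \<in> Obj C \<and> Cod C f \<in> Obj C) \<and>
     (\<forall>X \<in> Obj C. Ident C X \<in> Hom C X X) \<and>
     (\<forall>f \<in> Arr C. \<forall>g \<in> Arr C. Cod C f = Dom C g \<longrightarrow> Comp C g f \<in> Hom C (Dom C f) (Cod C g)) \<and>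
     (\<forall>f \<in> Arr C. Comp C f (Ident C (Dom C f)) = f \<and> Comp C (Ident C (Cod C f)) f = f) \<and>
     (\<forall>f \<in> Arr C. \<forall>g \<in> Arr C. \<forall>h \<in> Arr C. Cod C f = Dom C g \<and> Cod C g = Dom C h \<longrightarrow>
        Comp C h (Comp C g f) = Comp C (Comp C h g) f)"

definition locally_small :: "('o, 'v) cat \<Rightarrow> bool" where
  "locally_small C \<longleftrightarrow> (\<forall>X \<in> Obj C. \<forall>Y \<in> Obj C. small (Hom C X Y))"

definition isomorphic :: "('o, 'a) cat \<Rightarrow> 'o \<Rightarrow> 'o \<Rightarrow> bool" where
  "isomorphic C X Y \<longleftrightarrow>
     (\<exists>f \<in> Hom C X Y. \<exists>g \<in> Hom C Y X. Comp C g f = Ident C X \<and> Comp C f g = Ident C Y)"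

record ('i, 'j, 'o, 'a) func =
  ob_map :: "'i \<Rightarrow> 'o"
  ar_map :: "'j \<Rightarrow> 'a"

definition is_functor :: "('i, 'j) cat \<Rightarrow> ('o, 'a) cat \<Rightarrow> ('i, 'j, 'o, 'a) func \<Rightarrow> bool" where
  "is_functor J C F \<longleftrightarrow>
     (\<forall>i \<in> Obj J. ob_map F i \<in> Obj C) \<and>
     (\<forall>u \<in> Arr J. ar_map F u \<in> Hom C (ob_map F (Dom J u)) (ob_map F (Cod J u))) \<and>
     (\<forall>i \<in> Obj J. ar_map F (Ident J i) = Ident C (ob_map F i)) \<and>
     (\<forall>u \<in> Arr J. \<forall>w \<in> Arr J. Cod J u = Dom J w \<longrightarrow>
        ar_map F (Comp J w u) = Comp C (ar_map F w) (ar_map F u))"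

definition comp_func ::
  "('o, 'a, 'p, 'b) func \<Rightarrow> ('i, 'j, 'o, 'a) func \<Rightarrow> ('i, 'j, 'p, 'b) func" where
  "comp_func G F = \<lparr> ob_map = ob_map G \<circ> ob_map F, ar_map = ar_map G \<circ> ar_map F \<rparr>"


definition is_cocone ::
  "('i, 'j) cat \<Rightarrow> ('o, 'a) cat \<Rightarrow> ('i, 'j, 'o, 'a) func \<Rightarrow> 'o \<Rightarrow> ('i \<Rightarrow> 'a) \<Rightarrow> bool" where
  "is_cocone J C D c t \<longleftrightarrow>
     c \<in> Obj C \<and> (\<forall>i \<in> Obj J. t i \<in> Hom C (ob_map D i) c) \<and>
     (\<forall>u \<in> Arr J. Comp C (t (Cod J u)) (ar_map D u) = t (Dom J u))"

definition is_colimit ::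
  "('i, 'j) cat \<Rightarrow> ('o, 'a) cat \<Rightarrow> ('i, 'j, 'o, 'a) func \<Rightarrow> 'o \<Rightarrow> ('i \<Rightarrow> 'a) \<Rightarrow> bool" where
  "is_colimit J C D c t \<longleftrightarrow>
     is_cocone J C D c t \<and>
     (\<forall>c' t'. is_cocone J C D c' t' \<longrightarrow>
        (\<exists>!h. h \<in> Hom C c c' \<and> (\<forall>i \<in> Obj J. Comp C h (t i) = t' i)))"

definition is_cone ::
  "('i, 'j) cat \<Rightarrow> ('o, 'a) cat \<Rightarrow> ('i, 'j, 'o, 'a) func \<Rightarrow> 'o \<Rightarrow> ('i \<Rightarrow> 'a) \<Rightarrow> bool" where
  "is_cone J C D c t \<longleftrightarrow>
     c \<in> Obj C \<and> (\<forall>i \<in> Obj J. t i \<in> Hom C c (ob_map D i)) \<and>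
     (\<forall>u \<in> Arr J. Comp C (ar_map D u) (t (Dom J u)) = t (Cod J u))"

definition is_limit ::
  "('i, 'j) cat \<Rightarrow> ('o, 'a) cat \<Rightarrow> ('i, 'j, 'o, 'a) func \<Rightarrow> 'o \<Rightarrow> ('i \<Rightarrow> 'a) \<Rightarrow> bool" where
  "is_limit J C D c t \<longleftrightarrow>
     is_cone J C D c t \<and>
     (\<forall>c' t'. is_cone J C D c' t' \<longrightarrow>
        (\<exists>!h. h \<in> Hom C c' c \<and> (\<forall>i \<in> Obj J. Comp C (t i) h = t' i)))"

text \<open>The connected categories are nonempty; in particular a terminal object is not a connected limit.\<close>

definition connected_category :: "('i, 'j) cat \<Rightarrow> bool" where
  "connected_category J \<longleftrightarrow>
     category J \<and> Obj J \<noteq> {} \<and>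
     (\<forall>i \<in> Obj J. \<forall>k \<in> Obj J.
        (i, k) \<in> ({(Dom J u, Cod J u) | u. u \<in> Arr J} \<union> {(Cod J u, Dom J u) | u. u \<in> Arr J})\<^sup>*)"

definition has_connected_limits :: "('v, 'v) cat \<Rightarrow> bool" where
  "has_connected_limits K \<longleftrightarrow>
     (\<forall>(J :: ('v, 'v) cat) D.
        connected_category J \<and> small (Obj J) \<and> small (Arr J) \<and> is_functor J K D \<longrightarrow>
        (\<exists>c t. is_limit J K D c t))"


definition poset_cat :: "'i set \<Rightarrow> 'i rel \<Rightarrow> ('i, 'i \<times> 'i) cat" where
  "poset_cat I le =
     \<lparr> Obj = I, Arr = le, Dom = fst, Cod = snd, Ident = (\<lambda>i. (i, i)),
       Comp = (\<lambda>g f. (fst f, snd g)) \<rparr>"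

text \<open>Taking \<open>S = {}\<close> shows that directed posets are nonempty.\<close>

definition directed_poset :: "'v rel \<Rightarrow> 'v set \<Rightarrow> 'v rel \<Rightarrow> bool" where
  "directed_poset \<mu> I le \<longleftrightarrow>
     small I \<and> partial_order_on I le \<and>
     (\<forall>S \<subseteq> I. |S| <o \<mu> \<longrightarrow> (\<exists>b \<in> I. \<forall>s \<in> S. (s, b) \<in> le))"

text \<open>
  The category of small sets and functions.  An arrow is a triple (domain, function, codomain), the
  function being \<open>undefined\<close> outside of its domain.
\<close>

definition set_cat :: "('v set, 'v set \<times> ('v \<Rightarrow> 'v) \<times> 'v set) cat" where
  "set_cat =
     \<lparr> Obj = {A. small A},
       Arr = {(A, f, B). small A \<and> small B \<and> f \<in> A \<rightarrow>\<^sub>E B},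
       Dom = (\<lambda>(A, f, B). A),
       Cod = (\<lambda>(A, f, B). B),
       Ident = (\<lambda>A. (A, restrict (\<lambda>x. x) A, A)),
       Comp = (\<lambda>(B', g, C) (A, f, B). (A, compose A g f, C)) \<rparr>"

definition hom_functor ::
  "('o, 'v) cat \<Rightarrow> 'o \<Rightarrow> ('o, 'v, 'v set, 'v set \<times> ('v \<Rightarrow> 'v) \<times> 'v set) func" where
  "hom_functor K M =
     \<lparr> ob_map = (\<lambda>N. Hom K M N),
       ar_map = (\<lambda>g. (Hom K M (Dom K g),
                      restrict (\<lambda>f. Comp K g f) (Hom K M (Dom K g)),
                      Hom K M (Cod K g))) \<rparr>"

definition preserves_directed_colimits ::
  "'v rel \<Rightarrow> ('o, 'a) cat \<Rightarrow> ('p, 'b) cat \<Rightarrow> ('o, 'a, 'p, 'b) func \<Rightarrow> bool" where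
  "preserves_directed_colimits \<mu> K L F \<longleftrightarrow>
     (\<forall>I le D c t.
        directed_poset \<mu> I le \<and> is_functor (poset_cat I le) K D \<and>
        is_colimit (poset_cat I le) K D c t \<longrightarrow>
        is_colimit (poset_cat I le) L (comp_func F D) (ob_map F c) (ar_map F \<circ> t))"

definition presentable :: "('v, 'v) cat \<Rightarrow> 'v rel \<Rightarrow> 'v \<Rightarrow> bool" where
  "presentable K \<mu> M \<longleftrightarrow>
     M \<in> Obj K \<and> preserves_directed_colimits \<mu> K set_cat (hom_functor K M)"

definition has_directed_colimits :: "('v, 'v) cat \<Rightarrow> 'v rel \<Rightarrow> bool" where
  "has_directed_colimits K \<mu> \<longleftrightarrow>
     (\<forall>I le D. directed_poset \<mu> I le \<and> is_functor (poset_cat I le) K D \<longrightarrow>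
        (\<exists>c t. is_colimit (poset_cat I le) K D c t))"

definition accessible_at :: "('v, 'v) cat \<Rightarrow> 'v rel \<Rightarrow> bool" where
  "accessible_at K \<mu> \<longleftrightarrow>
     has_directed_colimits K \<mu> \<and>
     (\<exists>S \<subseteq> Obj K. small S \<and> (\<forall>M. presentable K \<mu> M \<longrightarrow> (\<exists>N \<in> S. isomorphic K M N))) \<and>
     (\<forall>M \<in> Obj K. \<exists>I le D t.
        directed_poset \<mu> I le \<and> is_functor (poset_cat I le) K D \<and>
        (\<forall>i \<in> I. presentable K \<mu> (ob_map D i)) \<and>
        is_colimit (poset_cat I le) K D M t)"

definition accessible :: "('v, 'v) cat \<Rightarrow> bool" where
  "accessible K \<longleftrightarrow>
     category K \<and> locally_small K \<and> (\<exists>\<mu>. small_regular \<mu> \<and> accessible_at K \<mu>)"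

definition large :: "('v, 'v) cat \<Rightarrow> bool" where
  "large K \<longleftrightarrow>
     (\<exists>S \<subseteq> Obj K. \<not> small S \<and> (\<forall>M \<in> S. \<forall>N \<in> S. M \<noteq> N \<longrightarrow> \<not> isomorphic K M N))"

definition locally_multipresentable :: "('v, 'v) cat \<Rightarrow> bool" where
  "locally_multipresentable K \<longleftrightarrow> accessible K \<and> has_connected_limits K"


text \<open>
  Rank and internal size are cardinals, hence determined only up to \<open>=o\<close>; they are given as
  relations between an object and a cardinal.
\<close>

definition is_presentability_rank :: "('v, 'v) cat \<Rightarrow> 'v \<Rightarrow> 'v rel \<Rightarrow> bool" where
  "is_presentability_rank K M \<rho> \<longleftrightarrow>
     small_regular \<rho> \<and> presentable K \<rho> M \<and>
     (\<forall>\<mu>. small_regular \<mu> \<and> presentable K \<mu> M \<longrightarrow> \<rho> \<le>o \<mu>)"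

definition is_internal_size :: "('v, 'v) cat \<Rightarrow> 'v \<Rightarrow> 'v rel \<Rightarrow> bool" where
  "is_internal_size K M \<chi> \<longleftrightarrow>
     small_cardinal \<chi> \<and>
     (\<exists>\<rho>. is_presentability_rank K M \<rho> \<and>
        (\<rho> =o cardSuc \<chi> \<or> limit_cardinal \<rho> \<and> \<chi> =o \<rho>))"

definition weakly_LS_accessible :: "('v, 'v) cat \<Rightarrow> bool" where
  "weakly_LS_accessible K \<longleftrightarrow>
     (\<exists>\<mu> :: 'v rel. small_cardinal \<mu> \<and>
        (\<forall>\<mu>'. small_regular \<mu>' \<and> \<mu> \<le>o \<mu>' \<longrightarrow> (\<exists>M \<in> Obj K. is_internal_size K M \<mu>')))"

end

theory Submission
  imports Defs
begin

text \<open>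
  Let \<open>K\<close> be \<open>\<mu>\<close>-accessible with connected limits, and call \<open>elements\<close> of \<open>A\<close> the arrows to \<open>A\<close> from a
  set \<open>S\<close> of representatives of the \<open>\<mu>\<close>-presentable objects.  Connected limits give a left multiadjoint
  to the functor sending \<open>A\<close> to its set of elements: every small family of elements of \<open>N\<close> lifts to a
  hull \<open>H \<rightarrow> N\<close> generated by the family, and hulls of families of size \<open>< \<rho>\<close> are \<open>\<rho>\<close>-presentable for
  every regular \<open>\<rho> \<ge> \<mu>\<close>.

  Let \<open>\<lambda> \<ge> \<mu>\<close> be regular.  Families of size \<open>< \<lambda>\<close> factor through objects with a bounded number of
  elements, so in an object \<open>N\<close> with more elements than that bound one can choose elements \<open>x j\<close>,
  \<open>j < \<lambda>\<close>, such that \<open>x j\<close> does not lift to the hull of \<open>x i\<close>, \<open>i < j\<close>.  The hull \<open>H\<close> of the whole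
  family is \<open>\<lambda>\<^sup>+\<close>-presentable.  It is a retract of the colimit of the chain of hulls of the initial
  segments; if it were \<open>\<lambda>\<close>-presentable, the section would factor through some stage \<open>j\<close>, and
  \<open>x j\<close> would lift to that stage.  So the rank of \<open>H\<close> is \<open>\<lambda>\<^sup>+\<close>, for every regular \<open>\<lambda> \<ge> \<mu>\<close>.
\<close>

section \<open>Smallness\<close>

text \<open>Products and initial objects may be missing, so a family of elements need not have a
  free object. Limits can be taken only over diagrams of objects above a fixed \<open>N\<close>.
  This is why a hull depends on its ambient object and why its universal property is expressed by
  sections of arrows into it. Closing a set of size \<lambda> under bounds of subsets of size
  \<open>< \<mu>\<close> may produce more than \<lambda> members; with no arithmetic relation
  between \<lambda> and \<mu> at hand, their number is estimated by 2^\<lambda>. The bound on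
  elements is then 2^\<lambda> times the number of arrows inside \<open>S\<close>. Such a crude
  bound is harmless, because \<open>N\<close> only has to exceed it, while the presentability of a
  hull depends on the number of its generators and not on the number of its elements. Hence every
  regular \<lambda> from \<mu> on is reached. Regularity of \<lambda> makes the well-order \<lambda>
  itself \<lambda>-directed, so that \<lambda>-presentability can be tested on a chain of hulls.
  Internal size \<lambda> comes from the successor clause of its definition.\<close>

lemma in_ordLeq_card: "A \<subseteq> f ` B \<Longrightarrow> |A| \<le>o |B|"
  by (meson card_of_image card_of_mono1 ordLeq_transitive)

locale universe =
  fixes \<kappa> :: "'v rel"
  assumes kappa: "\<kappa> = |UNIV :: 'v set|" and inaccessible: "strongly_inaccessible \<kappa>"
begin

text \<open>\<open>small\<close> is confined to subsets of \<open>'v\<close>; this version also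
  measures sets of pairs, of functions and of sets, whose types differ from
  \<open>'v\<close>.\<close>

abbreviation is_small :: "'b set \<Rightarrow> bool" where
  "is_small A \<equiv> |A| <o \<kappa>"

lemma infinite_UNIV: "infinite (UNIV :: 'v set)"
  using inaccessible unfolding strongly_inaccessible_def kappa
  by (meson infinite_iff_natLeq_ordLeq ordLess_imp_ordLeq)

text \<open>Regularity in the form that closes smallness under sums indexed by small sets.\<close>

lemma stable_UNIV: "stable \<kappa>"
  using inaccessible infinite_UNIV unfolding strongly_inaccessible_def
  by (intro regularCard_stable) (auto simp: kappa Field_card_of)

lemma small_subset: "is_small B \<Longrightarrow> A \<subseteq> B \<Longrightarrow> is_small A"
  using card_of_mono1 ordLeq_ordLess_trans by blast

lemma small_image: "is_small A \<Longrightarrow> is_small (f ` A)"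
  using card_of_image ordLeq_ordLess_trans by blast

lemma small_ordLeq: "is_small B \<Longrightarrow> |A| \<le>o |B| \<Longrightarrow> is_small A"
  using ordLeq_ordLess_trans by blast

lemma small_finite: "finite A \<Longrightarrow> is_small A"
  using infinite_UNIV unfolding kappa by (simp add: finite_ordLess_infinite[OF card_of_Well_order card_of_Well_order] Field_card_of)

lemma small_Sigma: "is_small A \<Longrightarrow> (\<And>a. a \<in> A \<Longrightarrow> is_small (F a)) \<Longrightarrow> is_small (Sigma A F)"
  by (rule stable_elim[OF stable_UNIV])

lemma small_UN: "is_small A \<Longrightarrow> (\<And>a. a \<in> A \<Longrightarrow> is_small (F a)) \<Longrightarrow> is_small (\<Union>a\<in>A. F a)"
  using small_Sigma[of A F] card_of_UNION_Sigma ordLeq_ordLess_trans by blast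

lemma small_Un: "is_small A \<Longrightarrow> is_small B \<Longrightarrow> is_small (A \<union> B)"
  unfolding kappa using card_of_Un_ordLess_infinite[OF infinite_UNIV] by blast

lemma small_insert: "is_small A \<Longrightarrow> is_small (insert a A)"
  using small_Un[of "{a}" A] small_finite[of "{a}"] by simp

lemma small_Times: "is_small A \<Longrightarrow> is_small B \<Longrightarrow> is_small (A \<times> B)"
  by (rule small_Sigma)

lemma small_embed:
  assumes "is_small A"
  obtains e :: "'b \<Rightarrow> 'v" where "inj_on e A"
  using assms unfolding kappa by (meson card_of_ordLeq ordLess_imp_ordLeq)

lemma small_copy:
  assumes "is_small A"
  obtains B :: "'v set" where "small B" "|A| =o |B|"
proof -
  obtain e :: "_ \<Rightarrow> 'v" where e: "inj_on e A" using small_embed[OF assms] by blast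
  then have "|A| =o |e ` A|" by (meson card_of_ordIso inj_on_imp_bij_betw)
  then show thesis using that[of "e ` A"] small_image[OF assms] by (auto simp: small_def kappa)
qed

text \<open>Inaccessibility speaks only of subsets of \<open>'v\<close>, hence the detour through an
  injection into \<open>'v\<close>.\<close>

lemma small_Pow: assumes "is_small A" shows "is_small (Pow A)"
proof -
  obtain e :: "_ \<Rightarrow> 'v" where e: "inj_on e A" using small_embed[OF assms] by blast
  have "is_small (Pow (e ` A))"
    using inaccessible small_image[OF assms] unfolding strongly_inaccessible_def by blast
  moreover have "|Pow A| \<le>o |Pow (e ` A)|"
    using e by (intro card_of_ordLeqI[of "(`) e"] inj_on_image_Pow) auto
  ultimately show ?thesis using small_ordLeq by blast
qed

text \<open>A function in the product is determined by its graph over \<open>A\<close>, which is a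
  subset of \<open>Sigma A F\<close>.\<close>

lemma small_PiE:
  assumes "is_small A" "\<And>a. a \<in> A \<Longrightarrow> is_small (F a)"
  shows "is_small (PiE A F)"
proof (rule small_ordLeq)
  show "is_small (Pow (Sigma A F))" using assms by (intro small_Pow small_Sigma)
  show "|PiE A F| \<le>o |Pow (Sigma A F)|"
  proof (rule card_of_ordLeqI)
    show "inj_on (\<lambda>g. (\<lambda>a. (a, g a)) ` A) (PiE A F)"
    proof (rule inj_onI)
      fix g h assume g: "g \<in> PiE A F" "h \<in> PiE A F"
        and eq: "(\<lambda>a. (a, g a)) ` A = (\<lambda>a. (a, h a)) ` A"
      have "g a = h a" if "a \<in> A" for a
      proof -
        have "(a, g a) \<in> (\<lambda>a. (a, h a)) ` A" using that eq by blast
        then show ?thesis by auto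
      qed
      then show "g = h" using g PiE_ext by blast
    qed
  qed (auto simp: PiE_def Pi_def)
qed

text \<open>The strong limit property keeps the successor below \<open>\<kappa>\<close>, since it is
  at most the cardinality of a power set. As \<open>cardSuc r\<close> lives on the type
  \<open>'v set\<close>, while ranks are relations on \<open>'v\<close>, it is replaced by a
  copy.\<close>

lemma small_regular_cardSuc:
  assumes "small_regular (r :: 'v rel)"
  obtains s :: "'v rel" where "small_regular s" "s =o cardSuc r"
proof -
  have r: "Card_order r" "r <o \<kappa>" "Cinfinite r"
    using assms by (auto simp: small_regular_def small_cardinal_def kappa)
  have F: "|Field r| =o r" using r(1) card_of_Field_ordIso by blast
  have "is_small (Field r)" using F r(2) ordIso_ordLess_trans by blast
  then have P: "is_small (Pow (Field r))" by (rule small_Pow)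
  have "r <o |Pow (Field r)|" using r(1) by (rule Card_order_Pow)
  then have "cardSuc r \<le>o |Pow (Field r)|"
    using r(1) by (intro cardSuc_least card_of_Card_order)
  then have S: "cardSuc r <o \<kappa>" using P ordLeq_ordLess_trans by blast
  have "Card_order (cardSuc r)" using r(1) by (rule cardSuc_Card_order)
  then have F2: "|Field (cardSuc r)| =o cardSuc r" using card_of_Field_ordIso by blast
  have "is_small (Field (cardSuc r))" using F2 S ordIso_ordLess_trans by blast
  then obtain B :: "'v set" where B: "small B" "|Field (cardSuc r)| =o |B|" by (rule small_copy)
  have iso: "cardSuc r =o |B|" using B F2 ordIso_symmetric ordIso_transitive by blast
  have "Cinfinite (cardSuc r)" using r(3) by (simp add: Cinfinite_cardSuc)
  moreover have "regularCard (cardSuc r)" using r(3) by (rule regularCard_cardSuc)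
  ultimately have "Cinfinite |B|" "regularCard |B|"
    using iso Cinfinite_cong regularCard_ordIso by blast+
  then have "small_regular |B|" using B by (simp add: small_regular_def small_cardinal_def small_def kappa)
  then show thesis using that iso ordIso_symmetric by blast
qed

end

section \<open>Counting subsets of bounded size\<close>

lemma card_of_Pow_mono:
  assumes "|A| \<le>o |B|" shows "|Pow A| \<le>o |Pow B|"
proof -
  obtain e where "inj_on e A" "e ` A \<subseteq> B" using assms by (meson card_of_ordLeq)
  then show ?thesis
    by (intro card_of_ordLeqI[of "(`) e"] inj_on_image_Pow) auto
qed

text \<open>In cardinal arithmetic, (2^B)^r = 2^(B \<times> r) = 2^B. A subset with fewer than
  \<open>r\<close> members is coded by indexing its members by \<open>Field r\<close> and turning
  each member into a subset of \<open>B\<close> by \<open>e\<close>. The indexing is arbitrary, so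
  the count goes through a surjective decoding.\<close>

lemma card_bounded_subsets:
  fixes Y :: "'b set" and B :: "'c set" and r :: "'d rel"
  assumes Y: "|Y| \<le>o |Pow B|" and B: "infinite B" and r: "Card_order r" "r \<le>o |B|"
  shows "|{S. S \<subseteq> Y \<and> |S| <o r}| \<le>o |Pow B|"
proof -
  obtain e where e: "inj_on e Y" "e ` Y \<subseteq> Pow B" using Y by (meson card_of_ordLeq)
  define B' where "B' = insert None (Some ` B)"
  have "|B'| =o |B|"
  proof -
    have "|{None} \<union> Some ` B| \<le>o |B|"
      using B by (intro card_of_Un_ordLeq_infinite_Field)
        (auto simp: Field_card_of card_of_card_order_on card_of_image intro: card_of_singl_ordLeq)
    moreover have "|B| \<le>o |B'|" unfolding B'_def by (intro card_of_ordLeqI[of Some]) auto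
    ultimately show ?thesis by (simp add: B'_def ordIso_iff_ordLeq)
  qed
  have "|Field r| \<le>o |B|" using r card_of_Field_ordIso ordIso_ordLeq_trans by blast
  then have RB: "|Field r \<times> B'| \<le>o |B|"
    using B \<open>|B'| =o |B|\<close>
    by (intro card_of_Times_ordLeq_infinite_Field)
      (auto simp: Field_card_of card_of_card_order_on ordIso_iff_ordLeq)
  have "|{S. S \<subseteq> Y \<and> |S| <o r}| \<le>o |Pow (Field r \<times> B')|"
  proof (rule in_ordLeq_card)
    define F where "F Z = {y \<in> Y. \<exists>a. (a, None) \<in> Z \<and> {b. (a, Some b) \<in> Z} = e y}"
      for Z :: "('d \<times> 'c option) set"
    show "{S. S \<subseteq> Y \<and> |S| <o r} \<subseteq> F ` Pow (Field r \<times> B')"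
    proof clarify
      fix S assume S: "S \<subseteq> Y" "|S| <o r"
      have "|S| \<le>o |Field r|" using S(2) r(1) card_of_Field_ordIso ordLess_imp_ordLeq
          ordIso_symmetric ordLeq_ordIso_trans by blast
      then obtain h where h: "inj_on h S" "h ` S \<subseteq> Field r" by (meson card_of_ordLeq)
      define Z where "Z = {(h s, None) | s. s \<in> S} \<union> {(h s, Some b) | s b. s \<in> S \<and> b \<in> e s}"
      have Zs: "{b. (h s, Some b) \<in> Z} = e s" if "s \<in> S" for s
        using that h(1) unfolding Z_def inj_on_def by auto
      have ZN: "(a, None) \<in> Z \<longleftrightarrow> a \<in> h ` S" for a unfolding Z_def by auto
      have "F Z = S"
      proof
        show "F Z \<subseteq> S"
        proof
          fix y assume "y \<in> F Z"
          then obtain s where "y \<in> Y" "s \<in> S" "e s = e y" unfolding F_def using ZN Zs by auto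
          then show "y \<in> S" using e(1) S(1) by (metis inj_on_def subsetD)
        qed
        show "S \<subseteq> F Z" unfolding F_def using ZN Zs S(1) by blast
      qed
      moreover have "Z \<in> Pow (Field r \<times> B')" using h(2) e(2) S(1) unfolding Z_def B'_def by blast
      ultimately show "S \<in> F ` Pow (Field r \<times> B')" by blast
    qed
  qed
  moreover have "|Pow (Field r \<times> B')| \<le>o |Pow B|" using RB by (rule card_of_Pow_mono)
  ultimately show ?thesis using ordLeq_transitive by blast
qed

section \<open>Connected limits\<close>

locale small_hom_category = universe "|UNIV :: 'v set|" for K :: "('v, 'v) cat" +
  assumes category: "category K" and locally_small: "locally_small K"
begin

abbreviation comp (infixr "\<cdot>" 70) where "g \<cdot> f \<equiv> Comp K g f"

abbreviation hom where "hom \<equiv> Hom K"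

lemma hom_dom: "f \<in> hom X Y \<Longrightarrow> X \<in> Obj K"
  and hom_cod: "f \<in> hom X Y \<Longrightarrow> Y \<in> Obj K"
  using category unfolding category_def Hom_def by auto

lemma ident_in [intro]: "X \<in> Obj K \<Longrightarrow> Ident K X \<in> hom X X"
  using category unfolding category_def by auto

lemma comp_in: "g \<in> hom Y Z \<Longrightarrow> f \<in> hom X Y \<Longrightarrow> g \<cdot> f \<in> hom X Z"
  using category unfolding category_def Hom_def by auto

lemma comp_ident [simp]: "f \<in> hom X Y \<Longrightarrow> f \<cdot> Ident K X = f"
  and ident_comp [simp]: "f \<in> hom X Y \<Longrightarrow> Ident K Y \<cdot> f = f"
  using category unfolding category_def Hom_def by auto

lemma comp_assoc: "h \<in> hom Y Z \<Longrightarrow> g \<in> hom X Y \<Longrightarrow> f \<in> hom W X \<Longrightarrow> (h \<cdot> g) \<cdot> f = h \<cdot> (g \<cdot> f)"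
  using category unfolding category_def Hom_def by auto

lemma small_hom: "is_small (hom X Y)"
proof (cases "X \<in> Obj K \<and> Y \<in> Obj K")
  case True then show ?thesis using locally_small unfolding locally_small_def small_def by auto
next
  case False then have "hom X Y = {}" using hom_dom hom_cod by blast
  then show ?thesis by (simp add: small_finite)
qed

lemma small_homs:
  assumes "is_small S" "is_small T"
  shows "is_small {f \<in> Arr K. Dom K f \<in> S \<and> Cod K f \<in> T}"
  by (rule small_subset[of "\<Union>X\<in>S. \<Union>Y\<in>T. hom X Y"])
    (intro small_UN assms small_hom, auto simp: Hom_def)

text \<open>Vertices of an arbitrary type, with arrows of \<open>K\<close> themselves as edge
  labels, spare each use the coding into \<open>'v\<close> that \<open>has_connected_limits\<close>
  demands.\<close>

definition concrete_cone :: "'w set \<Rightarrow> ('w \<Rightarrow> 'v) \<Rightarrow> ('w \<times> 'v \<times> 'w) set \<Rightarrow> 'v \<Rightarrow> ('w \<Rightarrow> 'v) \<Rightarrow> bool" where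
  "concrete_cone W ob R c t \<longleftrightarrow> c \<in> Obj K \<and> (\<forall>w\<in>W. t w \<in> hom c (ob w)) \<and>
     (\<forall>w u w'. (w, u, w') \<in> R \<longrightarrow> u \<cdot> t w = t w')"

text \<open>A diagram whose arrows are given as triples (source, arrow of \<open>K\<close>, target) and in which every
  vertex maps to the vertex \<open>z\<close>, which makes its shape connected.\<close>

lemma limit_of_diagram_with_sink:
  fixes W :: "'w set"
  assumes conn: "has_connected_limits K"
    and W: "is_small W" "\<And>w. w \<in> W \<Longrightarrow> ob w \<in> Obj K"
    and R: "\<And>w u w'. (w, u, w') \<in> R \<Longrightarrow> w \<in> W \<and> w' \<in> W \<and> u \<in> hom (ob w) (ob w')"
    and R_id: "\<And>w. w \<in> W \<Longrightarrow> (w, Ident K (ob w), w) \<in> R"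
    and R_comp: "\<And>w u w' u' w''. (w, u, w') \<in> R \<Longrightarrow> (w', u', w'') \<in> R \<Longrightarrow> (w, u' \<cdot> u, w'') \<in> R"
    and z: "z \<in> W" "\<And>w. w \<in> W \<Longrightarrow> \<exists>u. (w, u, z) \<in> R"
  shows "\<exists>c t. concrete_cone W ob R c t \<and> (\<forall>c' t'. concrete_cone W ob R c' t' \<longrightarrow>
    (\<exists>!h. h \<in> hom c' c \<and> (\<forall>w\<in>W. t w \<cdot> h = t' w)))"
proof -
  obtain e :: "'w \<Rightarrow> 'v" where e: "inj_on e W" using small_embed[OF W(1)] by blast
  have "is_small (SIGMA w:W. (\<Union>w'\<in>W. hom (ob w) (ob w')) \<times> W)"
    by (intro small_Sigma small_UN small_Times W small_hom)
  then have Rs: "is_small R" by (rule small_subset) (use R in fastforce)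
  obtain a :: "'w \<times> 'v \<times> 'w \<Rightarrow> 'v" where a: "inj_on a R" using small_embed[OF Rs] by blast
  define d where "d = inv_into W e"
  define b where "b = inv_into R a"
  have d: "d (e w) = w" if "w \<in> W" for w using that e by (simp add: d_def)
  have b: "b (a r) = r" if "r \<in> R" for r using that a by (simp add: b_def)
  \<comment> \<open>An arrow of \<open>J\<close> is the code of a whole triple, because one arrow of
    \<open>K\<close> may label edges between several pairs of vertices.\<close>
  define J :: "('v, 'v) cat" where "J = \<lparr> Obj = e ` W, Arr = a ` R, Dom = (\<lambda>v. e (fst (b v))),
    Cod = (\<lambda>v. e (snd (snd (b v)))), Ident = (\<lambda>i. a (d i, Ident K (ob (d i)), d i)),
    Comp = (\<lambda>v' v. a (fst (b v), fst (snd (b v')) \<cdot> fst (snd (b v)), snd (snd (b v')))) \<rparr>"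
  define D :: "('v, 'v, 'v, 'v) func" where "D = \<lparr> ob_map = (\<lambda>i. ob (d i)), ar_map = (\<lambda>v. fst (snd (b v))) \<rparr>"
  have pairs: "\<exists>w u w' u' w''. f = a (w, u, w') \<and> (w, u, w') \<in> R \<and> f' = a (w', u', w'') \<and> (w', u', w'') \<in> R"
    if "f \<in> Arr J" "f' \<in> Arr J" "Cod J f = Dom J f'" for f f'
  proof -
    obtain w u w' w1 u' w'' where f: "f = a (w, u, w')" "(w, u, w') \<in> R"
      "f' = a (w1, u', w'')" "(w1, u', w'') \<in> R" using \<open>f \<in> Arr J\<close> \<open>f' \<in> Arr J\<close> by (auto simp: J_def)
    have "e w' = e w1" using that(3) f by (simp add: J_def b)
    then have "w1 = w'" using e R[OF f(2)] R[OF f(4)] by (auto simp: inj_on_def)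
    then show ?thesis using f by blast
  qed
  have cat: "category J"
    unfolding category_def
  proof (intro conjI ballI impI)
    fix f assume "f \<in> Arr J"
    then obtain w u w' where f: "f = a (w, u, w')" "(w, u, w') \<in> R" by (auto simp: J_def)
    note r = R[OF f(2)]
    show "Dom J f \<in> Obj J" "Cod J f \<in> Obj J" using f r by (auto simp: J_def b)
    show "Comp J f (Ident J (Dom J f)) = f" "Comp J (Ident J (Cod J f)) f = f"
      using f r R_id by (auto simp: J_def b d)
  next
    fix f f' assume ff: "f \<in> Arr J" "f' \<in> Arr J" "Cod J f = Dom J f'"
    obtain w u w' u' w'' where f: "f = a (w, u, w')" "(w, u, w') \<in> R"
      "f' = a (w', u', w'')" "(w', u', w'') \<in> R" using pairs[OF ff] by blast
    then show "Comp J f' f \<in> Hom J (Dom J f) (Cod J f')"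
      using R_comp[OF f(2,4)] by (auto simp: J_def b Hom_def)
  next
    fix f f' f'' assume ff: "f \<in> Arr J" "f' \<in> Arr J" "f'' \<in> Arr J"
      and m: "Cod J f = Dom J f' \<and> Cod J f' = Dom J f''"
    obtain w u w' u' w'' where f: "f = a (w, u, w')" "(w, u, w') \<in> R"
      "f' = a (w', u', w'')" "(w', u', w'') \<in> R" using pairs[OF ff(1,2)] m by blast
    obtain u'' w3 where f'': "f'' = a (w'', u'', w3)" "(w'', u'', w3) \<in> R"
      using pairs[OF ff(2,3)] m f a by (metis inj_onD prod.inject)
    show "Comp J f'' (Comp J f' f) = Comp J (Comp J f'' f') f"
      using f f'' R[OF f(2)] R[OF f(4)] R[OF f''(2)] R_comp[OF f(2,4)] R_comp[OF f(4) f''(2)] comp_assoc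
      by (auto simp: J_def b)
  next
    fix i assume "i \<in> Obj J"
    then show "Ident J i \<in> Hom J i i" using R_id by (auto simp: J_def Hom_def b d)
  qed
  have "(i, e z) \<in> {(Dom J v, Cod J v) | v. v \<in> Arr J}" if "i \<in> Obj J" for i
  proof -
    obtain w where w: "i = e w" "w \<in> W" using \<open>i \<in> Obj J\<close> by (auto simp: J_def)
    obtain u where "(w, u, z) \<in> R" using z(2)[OF w(2)] by blast
    then have "a (w, u, z) \<in> Arr J" "Dom J (a (w, u, z)) = i" "Cod J (a (w, u, z)) = e z"
      using w by (auto simp: J_def b)
    then have "(i, e z) = (Dom J (a (w, u, z)), Cod J (a (w, u, z)))" by simp
    with \<open>a (w, u, z) \<in> Arr J\<close> show ?thesis by blast
  qed
  then have E: "(i, e z) \<in> {(Dom J v, Cod J v) | v. v \<in> Arr J} \<union> {(Cod J v, Dom J v) | v. v \<in> Arr J}"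
    "(e z, i) \<in> {(Dom J v, Cod J v) | v. v \<in> Arr J} \<union> {(Cod J v, Dom J v) | v. v \<in> Arr J}"
    if "i \<in> Obj J" for i using that by fastforce+
  have "connected_category J"
    unfolding connected_category_def
  proof (intro conjI ballI)
    show "Obj J \<noteq> {}" using z(1) by (auto simp: J_def)
    fix i k assume "i \<in> Obj J" "k \<in> Obj J"
    from rtrancl_trans[OF r_into_rtrancl[OF E(1)[OF this(1)]] r_into_rtrancl[OF E(2)[OF this(2)]]]
    show "(i, k) \<in> ({(Dom J v, Cod J v) | v. v \<in> Arr J} \<union> {(Cod J v, Dom J v) | v. v \<in> Arr J})\<^sup>*" .
  qed (rule cat)
  moreover have "small (Obj J)" "small (Arr J)"
    using W Rs by (auto simp: small_def J_def intro: small_image)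
  moreover have F: "is_functor J K D"
    unfolding is_functor_def
  proof (intro conjI ballI impI)
    fix i assume "i \<in> Obj J"
    then obtain w where w: "i = e w" "w \<in> W" by (auto simp: J_def)
    then show "ob_map D i \<in> Obj K" "ar_map D (Ident J i) = Ident K (ob_map D i)"
      using W R_id by (auto simp: D_def J_def d b)
  next
    fix f assume "f \<in> Arr J"
    then obtain w u w' where f: "f = a (w, u, w')" "(w, u, w') \<in> R" by (auto simp: J_def)
    then show "ar_map D f \<in> Hom K (ob_map D (Dom J f)) (ob_map D (Cod J f))"
      using R[OF f(2)] by (auto simp: D_def J_def d b)
  next
    fix f f' assume ff: "f \<in> Arr J" "f' \<in> Arr J" "Cod J f = Dom J f'"
    show "ar_map D (Comp J f' f) = ar_map D f' \<cdot> ar_map D f"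
      using pairs[OF ff] R_comp by (auto simp: D_def J_def d b)
  qed
  ultimately obtain c t where l: "is_limit J K D c t"
    using conn unfolding has_connected_limits_def by blast
  have cone: "is_cone J K D c' t' \<longleftrightarrow> concrete_cone W ob R c' (t' \<circ> e)" for c' t'
    unfolding is_cone_def concrete_cone_def using R
    by (auto simp: J_def D_def d b)
  show ?thesis
  proof (intro exI conjI allI impI)
    show "concrete_cone W ob R c (t \<circ> e)" using l cone unfolding is_limit_def by blast
    fix c' t' assume t': "concrete_cone W ob R c' t'"
    then have "concrete_cone W ob R c' ((t' \<circ> d) \<circ> e)"
      unfolding concrete_cone_def using R by (auto simp: d)
    then have "\<exists>!h. h \<in> hom c' c \<and> (\<forall>i\<in>Obj J. t i \<cdot> h = (t' \<circ> d) i)"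
      using l cone unfolding is_limit_def by blast
    then show "\<exists>!h. h \<in> hom c' c \<and> (\<forall>w\<in>W. (t \<circ> e) w \<cdot> h = t' w)"
      by (simp add: J_def d)
  qed
qed

section \<open>Pullbacks and equalizers\<close>

lemma pullback:
  assumes conn: "has_connected_limits K" and f: "f \<in> hom X Z" "g \<in> hom Y Z"
  obtains P p q where "p \<in> hom P X" "q \<in> hom P Y" "f \<cdot> p = g \<cdot> q"
    "\<And>c p' q'. p' \<in> hom c X \<Longrightarrow> q' \<in> hom c Y \<Longrightarrow> f \<cdot> p' = g \<cdot> q' \<Longrightarrow>
       \<exists>h\<in>hom c P. p \<cdot> h = p' \<and> q \<cdot> h = q'"
proof -
  define W where "W = {0, 1, 2 :: nat}"
  define ob where "ob w = (if w = 0 then X else if w = 1 then Y else Z)" for w :: nat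
  \<comment> \<open>The cospan together with its identities, so that \<open>R\<close> is closed
    under composition; vertex \<open>2\<close>, carrying \<open>Z\<close>, is the sink.\<close>
  define R where "R = {(0, Ident K X, 0), (1, Ident K Y, 1), (2, Ident K Z, 2), (0 :: nat, f, 2), (1, g, 2 :: nat)}"
  have O: "X \<in> Obj K" "Y \<in> Obj K" "Z \<in> Obj K" using f hom_dom hom_cod by blast+
  have cone0: "concrete_cone W ob R c t \<longleftrightarrow> c \<in> Obj K \<and> t 0 \<in> hom c X \<and> t 1 \<in> hom c Y \<and> t 2 \<in> hom c Z \<and> Ident K X \<cdot> t 0 = t 0 \<and> Ident K Y \<cdot> t 1 = t 1 \<and> Ident K Z \<cdot> t 2 = t 2 \<and> f \<cdot> t 0 = t 2 \<and> g \<cdot> t 1 = t 2" (is "_ = ?C") for c t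
  proof
    assume "concrete_cone W ob R c t"
    then have "c \<in> Obj K" "\<And>w. w \<in> W \<Longrightarrow> t w \<in> hom c (ob w)" "\<And>w u w'. (w, u, w') \<in> R \<Longrightarrow> u \<cdot> t w = t w'"
      unfolding concrete_cone_def by blast+
    from this(1) this(2)[of 0] this(2)[of 1] this(2)[of 2] this(3) show ?C by (simp add: W_def R_def ob_def)
  next
    assume ?C
    then show "concrete_cone W ob R c t"
      unfolding concrete_cone_def W_def R_def ob_def
      by (intro conjI ballI allI impI; (elim insertE emptyE)?) simp_all
  qed
  \<comment> \<open>The leg to the sink is forced by the others, so a cone amounts to a commuting
    square.\<close>
  have cone: "concrete_cone W ob R c t \<longleftrightarrow>
      t 0 \<in> hom c X \<and> t 1 \<in> hom c Y \<and> t 2 = f \<cdot> t 0 \<and> f \<cdot> t 0 = g \<cdot> t 1" for c t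
    unfolding cone0 using f by (metis comp_in hom_dom ident_comp)
  have ids: "f \<cdot> Ident K X = f" "g \<cdot> Ident K Y = g" "Ident K Z \<cdot> f = f" "Ident K Z \<cdot> g = g"
    "x \<in> Obj K \<Longrightarrow> Ident K x \<cdot> Ident K x = Ident K x" for x
    using f comp_ident[OF ident_in] by auto
  have "is_small W" by (simp add: W_def small_finite)
  moreover have "(w, u' \<cdot> u, w'') \<in> R" if "(w, u, w') \<in> R" "(w', u', w'') \<in> R" for w u w' u' w''
    using that O ids unfolding R_def by (elim insertE emptyE) simp_all
  moreover have "w \<in> W \<and> w' \<in> W \<and> u \<in> hom (ob w) (ob w')" if "(w, u, w') \<in> R" for w u w'
    using that f O ident_in unfolding R_def W_def ob_def by (elim insertE emptyE) simp_all
  ultimately have "\<exists>P t. concrete_cone W ob R P t \<and> (\<forall>c' t'. concrete_cone W ob R c' t' \<longrightarrow>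
    (\<exists>!h. h \<in> hom c' P \<and> (\<forall>w\<in>W. t w \<cdot> h = t' w)))"
    by (intro limit_of_diagram_with_sink[OF conn, of W ob R 2]) (use O in \<open>auto simp: W_def ob_def R_def\<close>)
  then obtain P t where P: "concrete_cone W ob R P t"
    and "\<forall>c' t'. concrete_cone W ob R c' t' \<longrightarrow> (\<exists>!h. h \<in> hom c' P \<and> (\<forall>w\<in>W. t w \<cdot> h = t' w))" by blast
  then have P2: "\<exists>h. h \<in> hom c' P \<and> (\<forall>w\<in>W. t w \<cdot> h = t' w)" if "concrete_cone W ob R c' t'" for c' t'
    using that by blast
  show thesis
  proof (rule that[of "t 0" P "t 1"])
    fix c p' q' assume p': "p' \<in> hom c X" "q' \<in> hom c Y" "f \<cdot> p' = g \<cdot> q'"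
    define t' where "t' w = (if w = 0 then p' else if w = 1 then q' else f \<cdot> p')" for w :: nat
    have "concrete_cone W ob R c t'" using p' by (simp add: cone t'_def)
    then obtain h where h: "h \<in> hom c P" "\<forall>w\<in>W. t w \<cdot> h = t' w" using P2 by blast
    then have "t 0 \<cdot> h = p'" "t 1 \<cdot> h = q'" by (auto simp: W_def t'_def)
    then show "\<exists>h\<in>hom c P. t 0 \<cdot> h = p' \<and> t 1 \<cdot> h = q'" using h by blast
  qed (use P cone in auto)
qed

lemma equalizer:
  assumes conn: "has_connected_limits K" and f: "f \<in> hom X Z" "g \<in> hom X Z"
  obtains P p where "p \<in> hom P X" "f \<cdot> p = g \<cdot> p"
    "\<And>c p'. p' \<in> hom c X \<Longrightarrow> f \<cdot> p' = g \<cdot> p' \<Longrightarrow> \<exists>h\<in>hom c P. p \<cdot> h = p'"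
proof -
  define W where "W = {0, 1 :: nat}"
  define ob where "ob w = (if w = 0 then X else Z)" for w :: nat
  define R where "R = {(0, Ident K X, 0), (1, Ident K Z, 1), (0 :: nat, f, 1), (0, g, 1 :: nat)}"
  have O: "X \<in> Obj K" "Z \<in> Obj K" using f hom_dom hom_cod by blast+
  have cone0: "concrete_cone W ob R c t \<longleftrightarrow> c \<in> Obj K \<and> t 0 \<in> hom c X \<and> t 1 \<in> hom c Z \<and> Ident K X \<cdot> t 0 = t 0 \<and> Ident K Z \<cdot> t 1 = t 1 \<and> f \<cdot> t 0 = t 1 \<and> g \<cdot> t 0 = t 1" (is "_ = ?C") for c t
  proof
    assume "concrete_cone W ob R c t"
    then have "c \<in> Obj K" "\<And>w. w \<in> W \<Longrightarrow> t w \<in> hom c (ob w)" "\<And>w u w'. (w, u, w') \<in> R \<Longrightarrow> u \<cdot> t w = t w'"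
      unfolding concrete_cone_def by blast+
    from this(1) this(2)[of 0] this(2)[of 1] this(3) show ?C by (simp add: W_def R_def ob_def)
  next
    assume ?C
    then show "concrete_cone W ob R c t"
      unfolding concrete_cone_def W_def R_def ob_def
      by (intro conjI ballI allI impI; (elim insertE emptyE)?) simp_all
  qed
  have cone: "concrete_cone W ob R c t \<longleftrightarrow>
      t 0 \<in> hom c X \<and> t 1 = f \<cdot> t 0 \<and> f \<cdot> t 0 = g \<cdot> t 0" for c t
    unfolding cone0 using f by (metis comp_in hom_dom ident_comp)
  have ids: "f \<cdot> Ident K X = f" "g \<cdot> Ident K X = g" "Ident K Z \<cdot> f = f" "Ident K Z \<cdot> g = g"
    "x \<in> Obj K \<Longrightarrow> Ident K x \<cdot> Ident K x = Ident K x" for x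
    using f comp_ident[OF ident_in] by auto
  have "is_small W" by (simp add: W_def small_finite)
  moreover have "(w, u' \<cdot> u, w'') \<in> R" if "(w, u, w') \<in> R" "(w', u', w'') \<in> R" for w u w' u' w''
    using that O ids unfolding R_def by (elim insertE emptyE) simp_all
  moreover have "w \<in> W \<and> w' \<in> W \<and> u \<in> hom (ob w) (ob w')" if "(w, u, w') \<in> R" for w u w'
    using that f O ident_in unfolding R_def W_def ob_def by (elim insertE emptyE) simp_all
  ultimately have "\<exists>P t. concrete_cone W ob R P t \<and> (\<forall>c' t'. concrete_cone W ob R c' t' \<longrightarrow>
    (\<exists>!h. h \<in> hom c' P \<and> (\<forall>w\<in>W. t w \<cdot> h = t' w)))"
    by (intro limit_of_diagram_with_sink[OF conn, of W ob R 1]) (use O in \<open>auto simp: W_def ob_def R_def\<close>)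
  then obtain P t where P: "concrete_cone W ob R P t"
    and "\<forall>c' t'. concrete_cone W ob R c' t' \<longrightarrow> (\<exists>!h. h \<in> hom c' P \<and> (\<forall>w\<in>W. t w \<cdot> h = t' w))" by blast
  then have P2: "\<exists>h. h \<in> hom c' P \<and> (\<forall>w\<in>W. t w \<cdot> h = t' w)" if "concrete_cone W ob R c' t'" for c' t'
    using that by blast
  show thesis
  proof (rule that[of "t 0" P])
    fix c p' assume p': "p' \<in> hom c X" "f \<cdot> p' = g \<cdot> p'"
    define t' where "t' w = (if w = 0 then p' else f \<cdot> p')" for w :: nat
    have "concrete_cone W ob R c t'" using p' by (simp add: cone t'_def)
    then obtain h where h: "h \<in> hom c P" "\<forall>w\<in>W. t w \<cdot> h = t' w" using P2 by blast
    then have "t 0 \<cdot> h = p'" by (auto simp: W_def t'_def)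
    then show "\<exists>h\<in>hom c P. t 0 \<cdot> h = p'" using h by blast
  qed (use P cone in auto)
qed

section \<open>Presentable objects\<close>

lemma functor_poset_iff:
  assumes "partial_order_on I le"
  shows "is_functor (poset_cat I le) K D \<longleftrightarrow>
    (\<forall>i\<in>I. ob_map D i \<in> Obj K) \<and>
    (\<forall>i j. (i, j) \<in> le \<longrightarrow> ar_map D (i, j) \<in> hom (ob_map D i) (ob_map D j)) \<and>
    (\<forall>i\<in>I. ar_map D (i, i) = Ident K (ob_map D i)) \<and>
    (\<forall>i j k. (i, j) \<in> le \<longrightarrow> (j, k) \<in> le \<longrightarrow> ar_map D (i, k) = ar_map D (j, k) \<cdot> ar_map D (i, j))"
  unfolding is_functor_def poset_cat_def by (simp add: split_paired_Ball_Sigma Ball_def split_paired_All)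

lemma cocone_poset_iff:
  "is_cocone (poset_cat I le) C D c t \<longleftrightarrow> c \<in> Obj C \<and> (\<forall>i\<in>I. t i \<in> Hom C (ob_map D i) c) \<and>
    (\<forall>i j. (i, j) \<in> le \<longrightarrow> Comp C (t j) (ar_map D (i, j)) = t i)"
  unfolding is_cocone_def poset_cat_def by auto

text \<open>Surjectivity (first clause) and injectivity (second clause) of the comparison map from
  the colimit of the sets \<open>hom M (ob_map D i)\<close> to \<open>hom M c\<close>. Over a
  directed poset, two arrows can always be moved to one stage before they are compared.\<close>

definition compact_at where
  "compact_at I le D c t M \<longleftrightarrow>
     (\<forall>h\<in>hom M c. \<exists>i\<in>I. \<exists>g\<in>hom M (ob_map D i). t i \<cdot> g = h) \<and>
     (\<forall>i\<in>I. \<forall>g\<in>hom M (ob_map D i). \<forall>g'\<in>hom M (ob_map D i). t i \<cdot> g = t i \<cdot> g' \<longrightarrow>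
        (\<exists>j. (i, j) \<in> le \<and> ar_map D (i, j) \<cdot> g = ar_map D (i, j) \<cdot> g'))"

lemma set_cat_hom_iff:
  "s \<in> Hom set_cat X A \<longleftrightarrow> small X \<and> small A \<and> (\<exists>f. s = (X, f, A) \<and> f \<in> X \<rightarrow>\<^sub>E A)"
  unfolding Hom_def set_cat_def by auto

lemma compose_hom_functor:
  assumes "u \<in> hom X Y" and "f \<in> hom M Y \<rightarrow>\<^sub>E A" "f' \<in> hom M X \<rightarrow>\<^sub>E A"
  shows "Comp set_cat (hom M Y, f, A) (ar_map (hom_functor K M) u) = (hom M X, f', A) \<longleftrightarrow>
    (\<forall>g\<in>hom M X. f (u \<cdot> g) = f' g)"
proof -
  have "Dom K u = X" using assms by (simp add: Hom_def)
  moreover have "compose (hom M X) f (restrict (\<lambda>g. u \<cdot> g) (hom M X)) = f' \<longleftrightarrow> (\<forall>g\<in>hom M X. f (u \<cdot> g) = f' g)"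
    using assms(3) by (auto simp: compose_def restrict_def fun_eq_iff PiE_def extensional_def)
  ultimately show ?thesis by (simp add: set_cat_def hom_functor_def)
qed

text \<open>Arrows of \<open>set_cat\<close> carry their domain and codomain. Both are forced here,
  so only the compatible family \<open>\<phi>\<close> of underlying functions remains free, and
  universal properties can be stated for functions instead of triples.\<close>

lemma hom_cocone_iff:
  assumes P: "partial_order_on I le" and D: "is_functor (poset_cat I le) K D"
  shows "is_cocone (poset_cat I le) set_cat (comp_func (hom_functor K M) D) A s \<longleftrightarrow>
    small A \<and> (\<exists>\<phi>. (\<forall>i\<in>I. s i = (hom M (ob_map D i), \<phi> i, A) \<and> \<phi> i \<in> hom M (ob_map D i) \<rightarrow>\<^sub>E A) \<and>
      (\<forall>i j. (i, j) \<in> le \<longrightarrow> (\<forall>g\<in>hom M (ob_map D i). \<phi> j (ar_map D (i, j) \<cdot> g) = \<phi> i g)))"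
    (is "?L \<longleftrightarrow> ?R")
proof -
  have sm: "small (hom M N)" for N using small_hom by (simp add: small_def)
  have le: "(i, j) \<in> le \<Longrightarrow> i \<in> I \<and> j \<in> I" for i j
    using P by (auto simp: partial_order_on_def preorder_on_def)
  have ar: "(i, j) \<in> le \<Longrightarrow> ar_map D (i, j) \<in> hom (ob_map D i) (ob_map D j)" for i j
    using D P by (simp add: functor_poset_iff)
  have "?L \<longleftrightarrow> small A \<and> (\<forall>i\<in>I. \<exists>f. s i = (hom M (ob_map D i), f, A) \<and> f \<in> hom M (ob_map D i) \<rightarrow>\<^sub>E A) \<and>
     (\<forall>i j. (i, j) \<in> le \<longrightarrow> Comp set_cat (s j) (ar_map (hom_functor K M) (ar_map D (i, j))) = s i)"
    unfolding cocone_poset_iff set_cat_hom_iff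
    by (auto simp: comp_func_def hom_functor_def sm) (auto simp: set_cat_def)
  also have "\<dots> \<longleftrightarrow> ?R"
  proof -
    have "(\<forall>i j. (i, j) \<in> le \<longrightarrow> Comp set_cat (s j) (ar_map (hom_functor K M) (ar_map D (i, j))) = s i) \<longleftrightarrow>
      (\<forall>i j. (i, j) \<in> le \<longrightarrow> (\<forall>g\<in>hom M (ob_map D i). \<phi> j (ar_map D (i, j) \<cdot> g) = \<phi> i g))"
      if \<phi>: "\<forall>i\<in>I. s i = (hom M (ob_map D i), \<phi> i, A) \<and> \<phi> i \<in> hom M (ob_map D i) \<rightarrow>\<^sub>E A" for \<phi>
    proof -
      have "Comp set_cat (s j) (ar_map (hom_functor K M) (ar_map D (i, j))) = s i \<longleftrightarrow>
        (\<forall>g\<in>hom M (ob_map D i). \<phi> j (ar_map D (i, j) \<cdot> g) = \<phi> i g)" if ij: "(i, j) \<in> le" for i j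
        using compose_hom_functor[OF ar[OF ij], of "\<phi> j" M A "\<phi> i"] \<phi> le[OF ij] by simp
      then show ?thesis by simp
    qed
    then show ?thesis unfolding bchoice_iff by blast
  qed
  finally show ?thesis .
qed

lemma ex1_image: "(\<exists>!h. \<exists>\<psi>. h = (X, \<psi>, A) \<and> Q \<psi>) \<longleftrightarrow> (\<exists>!\<psi>. Q \<psi>)"
proof
  assume "\<exists>!h. \<exists>\<psi>. h = (X, \<psi>, A) \<and> Q \<psi>"
  then obtain h where h: "\<exists>\<psi>. h = (X, \<psi>, A) \<and> Q \<psi>"
    and u: "\<And>h'. \<exists>\<psi>. h' = (X, \<psi>, A) \<and> Q \<psi> \<Longrightarrow> h' = h" by (rule ex1E) blast
  then obtain \<psi> where "h = (X, \<psi>, A)" "Q \<psi>" by blast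
  show "\<exists>!\<psi>. Q \<psi>"
  proof
    fix \<psi>' assume "Q \<psi>'" then show "\<psi>' = \<psi>" using u[of "(X, \<psi>', A)"] \<open>h = _\<close> by simp
  qed fact
next
  assume "\<exists>!\<psi>. Q \<psi>"
  then obtain \<psi> where "Q \<psi>" "\<forall>\<psi>'. Q \<psi>' \<longrightarrow> \<psi>' = \<psi>" by (rule ex1E)
  then show "\<exists>!h. \<exists>\<psi>. h = (X, \<psi>, A) \<and> Q \<psi>" by (intro ex1I[of _ "(X, \<psi>, A)"]) blast+
qed

lemma hom_colimit_universal:
  assumes P: "partial_order_on I le"
    and D: "is_functor (poset_cat I le) K D" and c: "is_cocone (poset_cat I le) K D c t"
  shows "is_colimit (poset_cat I le) set_cat (comp_func (hom_functor K M) D)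
      (ob_map (hom_functor K M) c) (ar_map (hom_functor K M) \<circ> t) \<longleftrightarrow>
    (\<forall>(A :: 'v set) \<phi>. small A \<longrightarrow> (\<forall>i\<in>I. \<phi> i \<in> hom M (ob_map D i) \<rightarrow>\<^sub>E A) \<longrightarrow>
      (\<forall>i j. (i, j) \<in> le \<longrightarrow> (\<forall>g\<in>hom M (ob_map D i). \<phi> j (ar_map D (i, j) \<cdot> g) = \<phi> i g)) \<longrightarrow>
      (\<exists>!\<psi>. \<psi> \<in> hom M c \<rightarrow>\<^sub>E A \<and> (\<forall>i\<in>I. \<forall>g\<in>hom M (ob_map D i). \<psi> (t i \<cdot> g) = \<phi> i g)))"
    (is "?L \<longleftrightarrow> ?R")
proof -
  let ?P = "poset_cat I le" let ?F = "comp_func (hom_functor K M) D"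
  let ?c = "ob_map (hom_functor K M) c" let ?t = "ar_map (hom_functor K M) \<circ> t"
  have sm: "small (hom M N)" for N using small_hom by (simp add: small_def)
  have t: "t i \<in> hom (ob_map D i) c" if "i \<in> I" for i using c that by (simp add: cocone_poset_iff)
  have tt: "t j \<cdot> ar_map D (i, j) = t i" if "(i, j) \<in> le" for i j using c that by (simp add: cocone_poset_iff)
  have le: "(i, j) \<in> le \<Longrightarrow> i \<in> I \<and> j \<in> I" for i j
    using P by (auto simp: partial_order_on_def preorder_on_def)
  have ar: "(i, j) \<in> le \<Longrightarrow> ar_map D (i, j) \<in> hom (ob_map D i) (ob_map D j)" for i j
    using D P by (simp add: functor_poset_iff)
  have "is_cocone ?P set_cat ?F ?c ?t"
    unfolding hom_cocone_iff[OF P D]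
  proof (intro conjI exI[of _ "\<lambda>i. restrict (\<lambda>g. t i \<cdot> g) (hom M (ob_map D i))"] ballI allI impI)
    fix i assume i: "i \<in> I"
    show "?t i = (hom M (ob_map D i), restrict (\<lambda>g. t i \<cdot> g) (hom M (ob_map D i)), ?c)"
      using t[OF i] by (simp add: hom_functor_def Hom_def)
    show "restrict (\<lambda>g. t i \<cdot> g) (hom M (ob_map D i)) \<in> hom M (ob_map D i) \<rightarrow>\<^sub>E ?c"
      using comp_in[OF t[OF i]] by (auto simp: hom_functor_def)
  next
    fix i j g assume "(i, j) \<in> le" "g \<in> hom M (ob_map D i)"
    then show "restrict (\<lambda>g. t j \<cdot> g) (hom M (ob_map D j)) (ar_map D (i, j) \<cdot> g) =
        restrict (\<lambda>g. t i \<cdot> g) (hom M (ob_map D i)) g"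
      using ar comp_in[OF ar] le tt comp_assoc[OF t ar, symmetric] by simp
  qed (simp add: hom_functor_def sm)
  then have "?L \<longleftrightarrow> (\<forall>A s. is_cocone ?P set_cat ?F A s \<longrightarrow>
      (\<exists>!h. h \<in> Hom set_cat ?c A \<and> (\<forall>i\<in>I. Comp set_cat h (?t i) = s i)))"
    by (simp add: is_colimit_def) (simp add: poset_cat_def)
  also have "\<dots> \<longleftrightarrow> (\<forall>(A :: 'v set) \<phi>. small A \<longrightarrow> (\<forall>i\<in>I. \<phi> i \<in> hom M (ob_map D i) \<rightarrow>\<^sub>E A) \<longrightarrow>
      (\<forall>i j. (i, j) \<in> le \<longrightarrow> (\<forall>g\<in>hom M (ob_map D i). \<phi> j (ar_map D (i, j) \<cdot> g) = \<phi> i g)) \<longrightarrow>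
      (\<exists>!h. h \<in> Hom set_cat ?c A \<and> (\<forall>i\<in>I. Comp set_cat h (?t i) = (hom M (ob_map D i), \<phi> i, A))))"
    unfolding hom_cocone_iff[OF P D]
  proof (intro iffI allI impI, goal_cases)
    case (1 A \<phi>)
    have "small A \<and> (\<exists>\<phi>'. (\<forall>i\<in>I. (hom M (ob_map D i), \<phi> i, A) = (hom M (ob_map D i), \<phi>' i, A) \<and>
        \<phi>' i \<in> hom M (ob_map D i) \<rightarrow>\<^sub>E A) \<and>
      (\<forall>i j. (i, j) \<in> le \<longrightarrow> (\<forall>g\<in>hom M (ob_map D i). \<phi>' j (ar_map D (i, j) \<cdot> g) = \<phi>' i g)))"
      using 1(2-4) by (intro conjI exI[of _ \<phi>]) simp_all
    then show ?case by (rule 1(1)[rule_format])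
  next
    case (2 A s)
    then obtain \<phi> where "\<forall>i\<in>I. s i = (hom M (ob_map D i), \<phi> i, A) \<and> \<phi> i \<in> hom M (ob_map D i) \<rightarrow>\<^sub>E A"
      "\<forall>i j. (i, j) \<in> le \<longrightarrow> (\<forall>g\<in>hom M (ob_map D i). \<phi> j (ar_map D (i, j) \<cdot> g) = \<phi> i g)" by blast
    with 2 show ?case by simp
  qed
  also have "\<dots> \<longleftrightarrow> ?R"
  proof -
    let ?e = "\<lambda>A \<phi>. \<exists>!h. h \<in> Hom set_cat ?c A \<and> (\<forall>i\<in>I. Comp set_cat h (?t i) = (hom M (ob_map D i), \<phi> i, A))"
    let ?m = "\<lambda>A \<phi> \<psi>. \<psi> \<in> hom M c \<rightarrow>\<^sub>E A \<and> (\<forall>i\<in>I. \<forall>g\<in>hom M (ob_map D i). \<psi> (t i \<cdot> g) = \<phi> i g)"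
    have "?e A \<phi> \<longleftrightarrow> (\<exists>!\<psi>. ?m A \<phi> \<psi>)"
      if A: "small A" and \<phi>: "\<forall>i\<in>I. \<phi> i \<in> hom M (ob_map D i) \<rightarrow>\<^sub>E A" for A \<phi>
    proof -
      let ?m = "\<lambda>\<psi>. \<psi> \<in> hom M c \<rightarrow>\<^sub>E A \<and> (\<forall>i\<in>I. \<forall>g\<in>hom M (ob_map D i). \<psi> (t i \<cdot> g) = \<phi> i g)"
      have m: "h \<in> Hom set_cat ?c A \<and> (\<forall>i\<in>I. Comp set_cat h (?t i) = (hom M (ob_map D i), \<phi> i, A)) \<longleftrightarrow>
        (\<exists>\<psi>. h = (hom M c, \<psi>, A) \<and> ?m \<psi>)" for h
      proof -
        have "Comp set_cat (hom M c, \<psi>, A) (?t i) = (hom M (ob_map D i), \<phi> i, A) \<longleftrightarrow>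
          (\<forall>g\<in>hom M (ob_map D i). \<psi> (t i \<cdot> g) = \<phi> i g)" if "\<psi> \<in> hom M c \<rightarrow>\<^sub>E A" "i \<in> I" for \<psi> i
          using compose_hom_functor[OF t[OF that(2)] that(1)] \<phi> that(2) by simp
        then show ?thesis by (auto simp: set_cat_hom_iff A sm hom_functor_def)
      qed
      show "(\<exists>!h. h \<in> Hom set_cat ?c A \<and> (\<forall>i\<in>I. Comp set_cat h (?t i) = (hom M (ob_map D i), \<phi> i, A))) \<longleftrightarrow>
        (\<exists>!\<psi>. ?m \<psi>)"
        unfolding m by (rule ex1_image)
    qed
    then show ?thesis by (simp only: cong: imp_cong)
  qed
  finally show ?thesis .
qed

lemma directed_pair:
  assumes P: "directed_poset \<mu> I le" and mu: "small_regular \<mu>" and ij: "i \<in> I" "j \<in> I"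
  obtains k where "(i, k) \<in> le" "(j, k) \<in> le"
proof -
  have "|{i, j}| <o \<mu>"
    using mu by (intro finite_ordLess_infinite)
      (auto simp: small_regular_def small_cardinal_def cinfinite_def card_of_well_order_on Field_card_of
        card_order_on_well_order_on)
  moreover have "{i, j} \<subseteq> I" using ij by simp
  ultimately show thesis using P that unfolding directed_poset_def by (meson insertCI)
qed

text \<open>For the forward direction it suffices to test the universal property against cocones into a
  two-element set.\<close>

lemma hom_colimit_iff:
  assumes P: "directed_poset \<mu> I le" and mu: "small_regular \<mu>"
    and D: "is_functor (poset_cat I le) K D" and c: "is_cocone (poset_cat I le) K D c t"
  shows "is_colimit (poset_cat I le) set_cat (comp_func (hom_functor K M) D)
      (ob_map (hom_functor K M) c) (ar_map (hom_functor K M) \<circ> t) \<longleftrightarrow> compact_at I le D c t M"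
proof -
  have po: "partial_order_on I le" using P by (simp add: directed_poset_def)
  have le: "(i, j) \<in> le \<Longrightarrow> i \<in> I \<and> j \<in> I" for i j
    using po by (auto simp: partial_order_on_def preorder_on_def)
  have trans: "(i, j) \<in> le \<Longrightarrow> (j, k) \<in> le \<Longrightarrow> (i, k) \<in> le" for i j k
    using po by (auto simp: partial_order_on_def preorder_on_def trans_def)
  note D' = D[unfolded functor_poset_iff[OF po]]
  have ar: "(i, j) \<in> le \<Longrightarrow> ar_map D (i, j) \<in> hom (ob_map D i) (ob_map D j)" for i j
    using D' by blast
  have arc: "ar_map D (j, k) \<cdot> (ar_map D (i, j) \<cdot> g) = ar_map D (i, k) \<cdot> g"
    if "(i, j) \<in> le" "(j, k) \<in> le" "g \<in> hom M (ob_map D i)" for i j k g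
    using D' that comp_assoc[OF ar ar] by metis
  have t: "t i \<in> hom (ob_map D i) c" if "i \<in> I" for i using c that by (simp add: cocone_poset_iff)
  have tt: "t j \<cdot> (ar_map D (i, j) \<cdot> g) = t i \<cdot> g" if "(i, j) \<in> le" "g \<in> hom M (ob_map D i)" for i j g
    using c that comp_assoc[OF t ar] le by (metis cocone_poset_iff)
  show ?thesis (is "?L \<longleftrightarrow> _")
  proof
    assume L: ?L
    note U = L[unfolded hom_colimit_universal[OF po D c], rule_format]
    obtain a b :: 'v where ab: "a \<noteq> b"
      using ex_new_if_finite[OF infinite_UNIV, of "{undefined}"] by auto
    have "small {a, b}" by (simp add: small_def small_finite)
    \<comment> \<open>A predicate \<open>\<chi>\<close> on the arrows into the stages that is
      invariant under the transition maps is a cocone into \<open>{a, b}\<close>, and therefore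
      descends to \<open>hom M c\<close>.\<close>
    then have test: "\<exists>!\<psi>. \<psi> \<in> hom M c \<rightarrow>\<^sub>E {a, b} \<and>
        (\<forall>i\<in>I. \<forall>g\<in>hom M (ob_map D i). \<psi> (t i \<cdot> g) = (if \<chi> i g then a else b))"
      if "\<And>i j g. (i, j) \<in> le \<Longrightarrow> g \<in> hom M (ob_map D i) \<Longrightarrow> \<chi> j (ar_map D (i, j) \<cdot> g) \<longleftrightarrow> \<chi> i g" for \<chi>
      using U[of "{a, b}" "\<lambda>i. restrict (\<lambda>g. if \<chi> i g then a else b) (hom M (ob_map D i))"]
        that comp_in[OF ar] by simp
    show "compact_at I le D c t M"
      unfolding compact_at_def
    proof (intro conjI ballI impI)
      fix h assume h: "h \<in> hom M c"
      show "\<exists>i\<in>I. \<exists>g\<in>hom M (ob_map D i). t i \<cdot> g = h"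
      proof (rule ccontr)
        assume "\<not> ?thesis"
        then have ne: "i \<in> I \<Longrightarrow> g \<in> hom M (ob_map D i) \<Longrightarrow> t i \<cdot> g \<noteq> h" for i g by blast
        \<comment> \<open>If \<open>h\<close> comes from no stage, changing the constant map at
          \<open>h\<close> alone is invisible to all stages, against uniqueness.\<close>
        let ?f1 = "restrict (\<lambda>_. a) (hom M c)"
        let ?f2 = "restrict (\<lambda>x. if x = h then b else a) (hom M c)"
        obtain \<psi> where u: "\<And>y. y \<in> hom M c \<rightarrow>\<^sub>E {a, b} \<Longrightarrow>
            (\<forall>i\<in>I. \<forall>g\<in>hom M (ob_map D i). y (t i \<cdot> g) = a) \<Longrightarrow> y = \<psi>"
          using test[of "\<lambda>_ _. True", OF refl] unfolding if_True by (rule ex1E) blast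
        have "?f1 = \<psi>" by (rule u) (use comp_in[OF t] in auto)
        moreover have "?f2 = \<psi>" by (rule u) (use comp_in[OF t] ne in auto)
        ultimately have "?f1 h = ?f2 h" by (simp only:)
        then show False using h ab by simp
      qed
    next
      fix i x y assume i: "i \<in> I" and x: "x \<in> hom M (ob_map D i)" and y: "y \<in> hom M (ob_map D i)"
        and eq: "t i \<cdot> x = t i \<cdot> y"
      \<comment> \<open>At some later stage, \<open>z\<close> becomes equal to \<open>x\<close>.
        This holds of \<open>x\<close> itself, hence also of every arrow with the same image in
        \<open>hom M c\<close>.\<close>
      define \<chi> where "\<chi> j z \<longleftrightarrow> (\<exists>k. (j, k) \<in> le \<and> (i, k) \<in> le \<and> ar_map D (j, k) \<cdot> z = ar_map D (i, k) \<cdot> x)" for j z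
      have "\<chi> j' (ar_map D (j, j') \<cdot> g) \<longleftrightarrow> \<chi> j g" if jj: "(j, j') \<in> le" and g: "g \<in> hom M (ob_map D j)" for j j' g
      proof
        assume "\<chi> j' (ar_map D (j, j') \<cdot> g)"
        then show "\<chi> j g" unfolding \<chi>_def using arc[OF jj _ g] trans[OF jj] by metis
      next
        assume "\<chi> j g"
        then obtain k where k: "(j, k) \<in> le" "(i, k) \<in> le" "ar_map D (j, k) \<cdot> g = ar_map D (i, k) \<cdot> x"
          unfolding \<chi>_def by blast
        obtain l where l: "(j', l) \<in> le" "(k, l) \<in> le" using directed_pair[OF P mu] le jj k by metis
        have "ar_map D (j', l) \<cdot> (ar_map D (j, j') \<cdot> g) = ar_map D (j, l) \<cdot> g" using arc jj l g by blast
        also have "\<dots> = ar_map D (k, l) \<cdot> (ar_map D (j, k) \<cdot> g)" using arc k l g by metis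
        also have "\<dots> = ar_map D (i, l) \<cdot> x" using arc k l x by metis
        finally show "\<chi> j' (ar_map D (j, j') \<cdot> g)" unfolding \<chi>_def using l trans k by blast
      qed
      from test[OF this] obtain \<psi> where
        \<psi>: "\<forall>i\<in>I. \<forall>g\<in>hom M (ob_map D i). \<psi> (t i \<cdot> g) = (if \<chi> i g then a else b)" by blast
      have "(i, i) \<in> le" using i po by (simp add: partial_order_on_def preorder_on_def refl_on_def)
      then have "\<chi> i x" unfolding \<chi>_def by blast
      then have "\<chi> i y" using \<psi> i x y eq ab by metis
      then show "\<exists>j. (i, j) \<in> le \<and> ar_map D (i, j) \<cdot> x = ar_map D (i, j) \<cdot> y" unfolding \<chi>_def by metis
    qed
  next
    assume C: "compact_at I le D c t M"
    then have C1: "\<exists>i\<in>I. \<exists>g\<in>hom M (ob_map D i). t i \<cdot> g = h" if "h \<in> hom M c" for h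
      using that unfolding compact_at_def by blast
    have C2: "\<exists>j. (i, j) \<in> le \<and> ar_map D (i, j) \<cdot> g = ar_map D (i, j) \<cdot> g'"
      if "i \<in> I" "g \<in> hom M (ob_map D i)" "g' \<in> hom M (ob_map D i)" "t i \<cdot> g = t i \<cdot> g'" for i g g'
      using that C unfolding compact_at_def by blast
    show ?L
      unfolding hom_colimit_universal[OF po D c]
    proof (intro allI impI)
      fix A \<phi> assume \<phi>A: "\<forall>i\<in>I. \<phi> i \<in> hom M (ob_map D i) \<rightarrow>\<^sub>E A"
        and \<phi>: "\<forall>i j. (i, j) \<in> le \<longrightarrow> (\<forall>g\<in>hom M (ob_map D i). \<phi> j (ar_map D (i, j) \<cdot> g) = \<phi> i g)"
      \<comment> \<open>The value prescribed at an arrow of \<open>hom M c\<close> does not depend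
        on its factorization, so \<open>\<psi>\<close> may pick one by \<open>SOME\<close>.\<close>
      have wd: "\<phi> i g = \<phi> j g'" if i: "i \<in> I" "g \<in> hom M (ob_map D i)" and j: "j \<in> I" "g' \<in> hom M (ob_map D j)"
        and eq: "t i \<cdot> g = t j \<cdot> g'" for i g j g'
      proof -
        obtain k where k: "(i, k) \<in> le" "(j, k) \<in> le" using directed_pair[OF P mu i(1) j(1)] by blast
        let ?g = "ar_map D (i, k) \<cdot> g" let ?g' = "ar_map D (j, k) \<cdot> g'"
        have gk: "?g \<in> hom M (ob_map D k)" "?g' \<in> hom M (ob_map D k)" using comp_in[OF ar] k i j by blast+
        have "t k \<cdot> ?g = t k \<cdot> ?g'" using tt k i j eq by metis
        then obtain l where l: "(k, l) \<in> le" "ar_map D (k, l) \<cdot> ?g = ar_map D (k, l) \<cdot> ?g'"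
          using C2 gk le k by blast
        have "\<phi> i g = \<phi> k ?g" using \<phi> k i by metis
        also have "\<dots> = \<phi> k ?g'" using \<phi> l gk by metis
        also have "\<dots> = \<phi> j g'" using \<phi> k j by metis
        finally show ?thesis .
      qed
      define \<psi> where "\<psi> = restrict (\<lambda>h. SOME v. \<exists>i\<in>I. \<exists>g\<in>hom M (ob_map D i). t i \<cdot> g = h \<and> v = \<phi> i g) (hom M c)"
      have val: "\<psi> (t i \<cdot> g) = \<phi> i g" if "i \<in> I" "g \<in> hom M (ob_map D i)" for i g
      proof -
        have "\<psi> (t i \<cdot> g) = (SOME v. \<exists>j\<in>I. \<exists>g'\<in>hom M (ob_map D j). t j \<cdot> g' = t i \<cdot> g \<and> v = \<phi> j g')"
          unfolding \<psi>_def using comp_in[OF t] that by simp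
        also have "\<dots> = \<phi> i g" by (rule some_equality) (use that wd in blast)+
        finally show ?thesis .
      qed
      show "\<exists>!\<psi>. \<psi> \<in> hom M c \<rightarrow>\<^sub>E A \<and> (\<forall>i\<in>I. \<forall>g\<in>hom M (ob_map D i). \<psi> (t i \<cdot> g) = \<phi> i g)"
      proof (intro ex1I conjI ballI)
        have "\<psi> h \<in> A" if h: "h \<in> hom M c" for h
        proof -
          obtain i g where "i \<in> I" "g \<in> hom M (ob_map D i)" "t i \<cdot> g = h" using C1[OF h] by blast
          then show ?thesis using val \<phi>A by (metis PiE_mem)
        qed
        then show "\<psi> \<in> hom M c \<rightarrow>\<^sub>E A" by (intro PiE_I) (auto simp: \<psi>_def)
      next
        fix \<psi>' assume a: "\<psi>' \<in> hom M c \<rightarrow>\<^sub>E A \<and> (\<forall>i\<in>I. \<forall>g\<in>hom M (ob_map D i). \<psi>' (t i \<cdot> g) = \<phi> i g)"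
        show "\<psi>' = \<psi>"
        proof
          fix h show "\<psi>' h = \<psi> h"
          proof (cases "h \<in> hom M c")
            case True
            then obtain i g where ig: "i \<in> I" "g \<in> hom M (ob_map D i)" "t i \<cdot> g = h" using C1 by blast
            have "\<psi>' (t i \<cdot> g) = \<phi> i g" using a ig(1,2) by blast
            then show ?thesis using val[OF ig(1,2)] ig(3) by simp
          next
            case False
            moreover from False have "\<psi>' h = undefined" using a PiE_arb by metis
            ultimately show ?thesis by (simp add: \<psi>_def)
          qed
        qed
      qed (rule val)
    qed
  qed
qed

lemma presentable_iff:
  assumes "small_regular \<mu>"
  shows "presentable K \<mu> M \<longleftrightarrow> M \<in> Obj K \<and> (\<forall>I le D c t. directed_poset \<mu> I le \<longrightarrow>
    is_functor (poset_cat I le) K D \<longrightarrow> is_colimit (poset_cat I le) K D c t \<longrightarrow> compact_at I le D c t M)"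
proof -
  have "is_colimit (poset_cat I le) set_cat (comp_func (hom_functor K M) D)
      (ob_map (hom_functor K M) c) (ar_map (hom_functor K M) \<circ> t) \<longleftrightarrow> compact_at I le D c t M"
    if "directed_poset \<mu> I le" "is_functor (poset_cat I le) K D" "is_colimit (poset_cat I le) K D c t" for I le D c t
    using hom_colimit_iff[OF that(1) assms that(2)] that(3) by (simp add: is_colimit_def)
  then show ?thesis unfolding presentable_def preserves_directed_colimits_def by blast
qed

section \<open>Isomorphisms, and arrows out of colimits\<close>

lemma isomorphicI:
  "f \<in> hom X Y \<Longrightarrow> g \<in> hom Y X \<Longrightarrow> g \<cdot> f = Ident K X \<Longrightarrow> f \<cdot> g = Ident K Y \<Longrightarrow> isomorphic K X Y"
  unfolding isomorphic_def by blast

lemma isomorphicE: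
  assumes "isomorphic K X Y"
  obtains f g where "f \<in> hom X Y" "g \<in> hom Y X" "g \<cdot> f = Ident K X" "f \<cdot> g = Ident K Y"
  using assms unfolding isomorphic_def by blast

lemma isomorphic_sym: "isomorphic K X Y \<Longrightarrow> isomorphic K Y X"
  unfolding isomorphic_def by blast

lemma isomorphic_trans:
  assumes "isomorphic K X Y" "isomorphic K Y Z"
  shows "isomorphic K X Z"
proof -
  obtain f g where f: "f \<in> hom X Y" "g \<in> hom Y X" "g \<cdot> f = Ident K X" "f \<cdot> g = Ident K Y"
    using assms(1) by (rule isomorphicE)
  obtain f' g' where f': "f' \<in> hom Y Z" "g' \<in> hom Z Y" "g' \<cdot> f' = Ident K Y" "f' \<cdot> g' = Ident K Z"
    using assms(2) by (rule isomorphicE)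
  have "(g \<cdot> g') \<cdot> (f' \<cdot> f) = g \<cdot> ((g' \<cdot> f') \<cdot> f)"
    using f(1,2) f'(1,2) by (simp add: comp_assoc[OF f(2) f'(2) comp_in] comp_assoc[OF f'(2,1) f(1)])
  moreover have "(f' \<cdot> f) \<cdot> (g \<cdot> g') = f' \<cdot> ((f \<cdot> g) \<cdot> g')"
    using f(1,2) f'(1,2) by (simp add: comp_assoc[OF f'(1) f(1) comp_in] comp_assoc[OF f(1,2) f'(2)])
  ultimately show ?thesis
    using f f' by (intro isomorphicI[of "f' \<cdot> f" _ _ "g \<cdot> g'"] comp_in[OF f'(1) f(1)] comp_in[OF f(2) f'(2)]) simp_all
qed

lemma colimit_poset_iff:
  "is_colimit (poset_cat I le) K D c t \<longleftrightarrow> is_cocone (poset_cat I le) K D c t \<and>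
    (\<forall>c' t'. is_cocone (poset_cat I le) K D c' t' \<longrightarrow> (\<exists>!h. h \<in> hom c c' \<and> (\<forall>i\<in>I. h \<cdot> t i = t' i)))"
  by (simp add: is_colimit_def) (simp add: poset_cat_def)

lemma colimit_obtain:
  assumes "is_colimit (poset_cat I le) K D c t" "is_cocone (poset_cat I le) K D c' t'"
  obtains h where "h \<in> hom c c'" "\<And>i. i \<in> I \<Longrightarrow> h \<cdot> t i = t' i"
  using assms unfolding colimit_poset_iff by blast

lemma colimit_unique:
  assumes c: "is_colimit (poset_cat I le) K D c t" and le: "le \<subseteq> I \<times> I"
    and D: "\<And>i j. (i, j) \<in> le \<Longrightarrow> ar_map D (i, j) \<in> hom (ob_map D i) (ob_map D j)"
    and h: "h \<in> hom c c'" "h' \<in> hom c c'" and eq: "\<And>i. i \<in> I \<Longrightarrow> h \<cdot> t i = h' \<cdot> t i"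
  shows "h = h'"
proof -
  have t: "i \<in> I \<Longrightarrow> t i \<in> hom (ob_map D i) c"
    and tt: "(i, j) \<in> le \<Longrightarrow> t j \<cdot> ar_map D (i, j) = t i" for i j
    using c unfolding colimit_poset_iff cocone_poset_iff by blast+
  have "is_cocone (poset_cat I le) K D c' (\<lambda>i. h \<cdot> t i)"
    unfolding cocone_poset_iff
  proof (intro conjI allI impI ballI)
    show "c' \<in> Obj K" using h hom_cod by blast
    fix i assume "i \<in> I" then show "h \<cdot> t i \<in> hom (ob_map D i) c'" using comp_in h t by blast
  next
    fix i j assume ij: "(i, j) \<in> le"
    then have "j \<in> I" using le by blast
    then show "(h \<cdot> t j) \<cdot> ar_map D (i, j) = h \<cdot> t i" using comp_assoc[OF h(1) t D] ij tt by simp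
  qed
  then have "\<exists>!k. k \<in> hom c c' \<and> (\<forall>i\<in>I. k \<cdot> t i = h \<cdot> t i)"
    using c unfolding colimit_poset_iff by blast
  then show ?thesis using h eq by (metis)
qed

end

section \<open>Accessible categories\<close>

locale accessible_category = small_hom_category +
  fixes \<mu> :: "'a rel" and S :: "'a set"
  assumes mu: "small_regular \<mu>"
    and directed_colimits: "has_directed_colimits K \<mu>"
    and small_S: "small S"
    and S_presentable: "\<And>N. N \<in> S \<Longrightarrow> presentable K \<mu> N"
    and S_represents: "\<And>M. presentable K \<mu> M \<Longrightarrow> \<exists>N\<in>S. isomorphic K M N"
    and presentable_colimits: "\<And>M. M \<in> Obj K \<Longrightarrow> \<exists>I le D t. directed_poset \<mu> I le \<and>
        is_functor (poset_cat I le) K D \<and> (\<forall>i\<in>I. presentable K \<mu> (ob_map D i)) \<and>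
        is_colimit (poset_cat I le) K D M t"
begin

lemma S_obj: "N \<in> S \<Longrightarrow> N \<in> Obj K"
  using S_presentable unfolding presentable_def by blast

text \<open>The diagram is conjugated with isomorphisms from its objects to representatives. Thereby
  the legs of the colimit become literal members of \<open>elements M\<close>.\<close>

lemma colimit_of_representatives:
  assumes "M \<in> Obj K"
  obtains I le D t where "directed_poset \<mu> I le" "is_functor (poset_cat I le) K D"
    "\<And>i. i \<in> I \<Longrightarrow> ob_map D i \<in> S" "is_colimit (poset_cat I le) K D M t"
proof -
  obtain I le and D :: "('a, 'a \<times> 'a, 'a, 'a) func" and t where P: "directed_poset \<mu> I le"
    and D: "is_functor (poset_cat I le) K D"
    and pres: "\<forall>i\<in>I. presentable K \<mu> (ob_map D i)" and col: "is_colimit (poset_cat I le) K D M t"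
    using presentable_colimits[OF assms] by blast
  have po: "partial_order_on I le" using P by (simp add: directed_poset_def)
  have le: "i \<in> I" "j \<in> I" if "(i, j) \<in> le" for i j
    using po that by (auto simp: partial_order_on_def preorder_on_def)
  note D' = D[unfolded functor_poset_iff[OF po]]
  have ar: "(i, j) \<in> le \<Longrightarrow> ar_map D (i, j) \<in> hom (ob_map D i) (ob_map D j)" for i j using D' by blast
  have arc: "(i, j) \<in> le \<Longrightarrow> (j, k) \<in> le \<Longrightarrow> ar_map D (i, k) = ar_map D (j, k) \<cdot> ar_map D (i, j)" for i j k
    using D' by blast
  have ari: "i \<in> I \<Longrightarrow> ar_map D (i, i) = Ident K (ob_map D i)" for i using D' by blast
  have t: "i \<in> I \<Longrightarrow> t i \<in> hom (ob_map D i) M"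
    and tt: "(i, j) \<in> le \<Longrightarrow> t j \<cdot> ar_map D (i, j) = t i" for i j
    using col unfolding colimit_poset_iff cocone_poset_iff by blast+
  have "\<forall>i\<in>I. \<exists>N f g. N \<in> S \<and> f \<in> hom (ob_map D i) N \<and> g \<in> hom N (ob_map D i) \<and>
    g \<cdot> f = Ident K (ob_map D i) \<and> f \<cdot> g = Ident K N"
    using pres S_represents unfolding isomorphic_def by blast
  then obtain N f g where N: "\<And>i. i \<in> I \<Longrightarrow> N i \<in> S" and f: "\<And>i. i \<in> I \<Longrightarrow> f i \<in> hom (ob_map D i) (N i)"
    and g: "\<And>i. i \<in> I \<Longrightarrow> g i \<in> hom (N i) (ob_map D i)" and gf: "\<And>i. i \<in> I \<Longrightarrow> g i \<cdot> f i = Ident K (ob_map D i)"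
    and fg: "\<And>i. i \<in> I \<Longrightarrow> f i \<cdot> g i = Ident K (N i)" by metis
  have xgf: "(x \<cdot> g i) \<cdot> f i = x" if "i \<in> I" "x \<in> hom (ob_map D i) Y" for i x Y
    using comp_assoc[OF that(2) g f] gf that by simp
  have xfg: "(x \<cdot> f i) \<cdot> g i = x" if "i \<in> I" "x \<in> hom (N i) Y" for i x Y
    using comp_assoc[OF that(2) f g] fg that by simp
  define a where "a i j = f j \<cdot> (ar_map D (i, j) \<cdot> g i)" for i j
  define E where "E = \<lparr> ob_map = N, ar_map = (\<lambda>(i, j). a i j) \<rparr>"
  have ag: "ar_map D (i, j) \<cdot> g i \<in> hom (N i) (ob_map D j)" if "(i, j) \<in> le" for i j
    using that ar g le comp_in by blast
  have a: "a i j \<in> hom (N i) (N j)" if "(i, j) \<in> le" for i j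
    unfolding a_def using f le that ag comp_in by blast
  have E: "is_functor (poset_cat I le) K E"
    unfolding functor_poset_iff[OF po] E_def
  proof (simp, intro conjI allI impI ballI)
    fix i assume i: "i \<in> I"
    show "N i \<in> Obj K" using N S_obj i by blast
    show "a i i = Ident K (N i)" using i ari g fg by (simp add: a_def ident_comp[OF g])
  next
    fix i j assume "(i, j) \<in> le" then show "a i j \<in> hom (N i) (N j)" by (rule a)
  next
    fix i j k assume ij: "(i, j) \<in> le" and jk: "(j, k) \<in> le"
    note i = le(1)[OF ij] and j = le(2)[OF ij] and k = le(2)[OF jk]
    have "a j k \<cdot> a i j = f k \<cdot> ((ar_map D (j, k) \<cdot> g j) \<cdot> (f j \<cdot> (ar_map D (i, j) \<cdot> g i)))"
      unfolding a_def using comp_assoc[OF f[OF k] ag[OF jk] a[OF ij]] by (simp add: a_def)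
    also have "(ar_map D (j, k) \<cdot> g j) \<cdot> (f j \<cdot> (ar_map D (i, j) \<cdot> g i)) =
        ((ar_map D (j, k) \<cdot> g j) \<cdot> f j) \<cdot> (ar_map D (i, j) \<cdot> g i)"
      using comp_assoc[OF ag[OF jk] f[OF j] ag[OF ij]] by simp
    also have "\<dots> = ar_map D (j, k) \<cdot> (ar_map D (i, j) \<cdot> g i)" using xgf[OF j ar[OF jk]] by simp
    also have "\<dots> = ar_map D (i, k) \<cdot> g i"
      using comp_assoc[OF ar[OF jk] ar[OF ij] g[OF i]] arc[OF ij jk] by simp
    finally show "a i k = a j k \<cdot> a i j" by (simp add: a_def)
  qed
  have cocone_E: "is_cocone (poset_cat I le) K E c s \<longleftrightarrow> c \<in> Obj K \<and> (\<forall>i\<in>I. s i \<in> hom (N i) c) \<and>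
      (\<forall>i j. (i, j) \<in> le \<longrightarrow> s j \<cdot> a i j = s i)" for c s
    unfolding cocone_poset_iff E_def by simp
  have tg: "i \<in> I \<Longrightarrow> t i \<cdot> g i \<in> hom (N i) M" for i using t g comp_in by blast
  have coc: "is_cocone (poset_cat I le) K E M (\<lambda>i. t i \<cdot> g i)"
    unfolding cocone_E
  proof (intro conjI ballI allI impI assms)
    fix i j assume ij: "(i, j) \<in> le"
    note i = le(1)[OF ij] and j = le(2)[OF ij]
    have "(t j \<cdot> g j) \<cdot> a i j = ((t j \<cdot> g j) \<cdot> f j) \<cdot> (ar_map D (i, j) \<cdot> g i)"
      unfolding a_def using comp_assoc[OF tg[OF j] f[OF j] ag[OF ij]] by simp
    also have "\<dots> = t j \<cdot> (ar_map D (i, j) \<cdot> g i)" using xgf[OF j t[OF j]] by simp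
    also have "\<dots> = t i \<cdot> g i" using comp_assoc[OF t[OF j] ar[OF ij] g[OF i]] tt[OF ij] by simp
    finally show "(t j \<cdot> g j) \<cdot> a i j = t i \<cdot> g i" .
  qed (rule tg)
  have "is_colimit (poset_cat I le) K E M (\<lambda>i. t i \<cdot> g i)"
    unfolding colimit_poset_iff
  proof (intro conjI coc allI impI)
    fix c s assume s: "is_cocone (poset_cat I le) K E c s"
    have s1: "i \<in> I \<Longrightarrow> s i \<in> hom (N i) c" and s2: "(i, j) \<in> le \<Longrightarrow> s j \<cdot> a i j = s i" for i j
      using s unfolding cocone_E by blast+
    have sf: "i \<in> I \<Longrightarrow> s i \<cdot> f i \<in> hom (ob_map D i) c" for i using s1 f comp_in by blast
    have "is_cocone (poset_cat I le) K D c (\<lambda>i. s i \<cdot> f i)"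
      unfolding cocone_poset_iff
    proof (intro conjI ballI allI impI)
      show "c \<in> Obj K" using s unfolding cocone_E by blast
      fix i j assume ij: "(i, j) \<in> le"
      note i = le(1)[OF ij] and j = le(2)[OF ij]
      have "s i \<cdot> f i = (s j \<cdot> (f j \<cdot> (ar_map D (i, j) \<cdot> g i))) \<cdot> f i" using s2[OF ij] by (simp add: a_def)
      also have "\<dots> = ((s j \<cdot> f j) \<cdot> (ar_map D (i, j) \<cdot> g i)) \<cdot> f i"
        using comp_assoc[OF s1[OF j] f[OF j] ag[OF ij]] by simp
      also have "\<dots> = (s j \<cdot> f j) \<cdot> ((ar_map D (i, j) \<cdot> g i) \<cdot> f i)"
        using comp_assoc[OF sf[OF j] ag[OF ij] f[OF i]] by simp
      also have "\<dots> = (s j \<cdot> f j) \<cdot> ar_map D (i, j)" using xgf[OF i ar[OF ij]] by simp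
      finally show "(s j \<cdot> f j) \<cdot> ar_map D (i, j) = s i \<cdot> f i" by simp
    qed (rule sf)
    then obtain h where h: "h \<in> hom M c" "\<And>i. i \<in> I \<Longrightarrow> h \<cdot> t i = s i \<cdot> f i" using colimit_obtain[OF col] by blast
    show "\<exists>!h. h \<in> hom M c \<and> (\<forall>i\<in>I. h \<cdot> (t i \<cdot> g i) = s i)"
    proof (intro ex1I conjI ballI)
      fix i assume i: "i \<in> I"
      have "h \<cdot> (t i \<cdot> g i) = (s i \<cdot> f i) \<cdot> g i" using comp_assoc[OF h(1) t[OF i] g[OF i]] h(2)[OF i] by simp
      also have "\<dots> = s i" using xfg[OF i s1[OF i]] .
      finally show "h \<cdot> (t i \<cdot> g i) = s i" .
    next
      fix h' assume h': "h' \<in> hom M c \<and> (\<forall>i\<in>I. h' \<cdot> (t i \<cdot> g i) = s i)"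
      show "h' = h"
      proof (rule colimit_unique[OF col _ ar conjunct1[OF h'] h(1)])
        fix i assume i: "i \<in> I"
        have "h' \<cdot> t i = ((h' \<cdot> t i) \<cdot> g i) \<cdot> f i"
          using xgf[OF i comp_in[OF conjunct1[OF h'] t[OF i]]] by simp
        also have "(h' \<cdot> t i) \<cdot> g i = s i" using comp_assoc[OF conjunct1[OF h'] t[OF i] g[OF i]] h' i by simp
        finally show "h' \<cdot> t i = h \<cdot> t i" using h(2)[OF i] by simp
      qed (use le in auto)
    qed (rule h(1))
  qed
  moreover have "\<And>i. i \<in> I \<Longrightarrow> ob_map E i \<in> S" using N by (simp add: E_def)
  ultimately show thesis using that P E by blast
qed

section \<open>Elements of objects and density of the representatives\<close>

definition elements :: "'a \<Rightarrow> 'a set" where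
  "elements A = {y \<in> Arr K. Dom K y \<in> S \<and> Cod K y = A}"

lemma elements_iff: "y \<in> elements A \<longleftrightarrow> Dom K y \<in> S \<and> y \<in> hom (Dom K y) A"
  by (auto simp: elements_def Hom_def)

lemma elements_comp: "m \<in> hom A B \<Longrightarrow> y \<in> elements A \<Longrightarrow> m \<cdot> y \<in> elements B \<and> Dom K (m \<cdot> y) = Dom K y"
  using comp_in[of m A B y] by (auto simp: elements_iff Hom_def)

lemma presentable_compact_at:
  assumes "presentable K \<mu> M" "directed_poset \<mu> I le"
    "is_functor (poset_cat I le) K D" "is_colimit (poset_cat I le) K D c t"
  shows "compact_at I le D c t M"
  using assms presentable_iff[OF mu] by blast

text \<open>The legs of a colimit of objects of \<open>S\<close> are elements.\<close>

lemma elements_jointly_epic: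
  assumes A: "A \<in> Obj K" and h: "h \<in> hom A B" "h' \<in> hom A B" and eq: "\<And>y. y \<in> elements A \<Longrightarrow> h \<cdot> y = h' \<cdot> y"
  shows "h = h'"
proof -
  obtain I le D t where D: "directed_poset \<mu> I le" "is_functor (poset_cat I le) K D"
    "\<And>i. i \<in> I \<Longrightarrow> ob_map D i \<in> S" "is_colimit (poset_cat I le) K D A t"
    using colimit_of_representatives[OF A] by blast
  have po: "partial_order_on I le" using D(1) by (simp add: directed_poset_def)
  have t: "i \<in> I \<Longrightarrow> t i \<in> hom (ob_map D i) A" for i
    using D(4) unfolding colimit_poset_iff cocone_poset_iff by blast
  show ?thesis
  proof (rule colimit_unique[OF D(4) _ _ h])
    show "le \<subseteq> I \<times> I" using po by (auto simp: partial_order_on_def preorder_on_def)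
    show "ar_map D (i, j) \<in> hom (ob_map D i) (ob_map D j)" if "(i, j) \<in> le" for i j
      using D(2) that unfolding functor_poset_iff[OF po] by blast
    fix i assume "i \<in> I"
    then have "t i \<in> elements A" using t D(3) by (auto simp: elements_def Hom_def)
    then show "h \<cdot> t i = h' \<cdot> t i" by (rule eq)
  qed
qed

text \<open>Density of \<open>S\<close>: between the sets of elements, regarded as presheaves on the
  full subcategory on \<open>S\<close>, every transformation is induced by an arrow of
  \<open>K\<close>. The arrow is assembled from the values of \<open>\<phi>\<close> at the legs of a
  colimit.\<close>

lemma arrow_of_natural_map:
  assumes A: "A \<in> Obj K" and B: "B \<in> Obj K"
    and \<phi>: "\<And>y. y \<in> elements A \<Longrightarrow> \<phi> y \<in> elements B \<and> Dom K (\<phi> y) = Dom K y"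
    and nat: "\<And>y u. y \<in> elements A \<Longrightarrow> u \<in> hom (Dom K u) (Dom K y) \<Longrightarrow> Dom K u \<in> S \<Longrightarrow> \<phi> (y \<cdot> u) = \<phi> y \<cdot> u"
  obtains h where "h \<in> hom A B" "\<And>y. y \<in> elements A \<Longrightarrow> h \<cdot> y = \<phi> y"
proof -
  obtain I le D t where D: "directed_poset \<mu> I le" "is_functor (poset_cat I le) K D"
    "\<And>i. i \<in> I \<Longrightarrow> ob_map D i \<in> S" "is_colimit (poset_cat I le) K D A t"
    using colimit_of_representatives[OF A] by blast
  have po: "partial_order_on I le" using D(1) by (simp add: directed_poset_def)
  have le: "i \<in> I" "j \<in> I" if "(i, j) \<in> le" for i j
    using po that by (auto simp: partial_order_on_def preorder_on_def)
  have ar: "ar_map D (i, j) \<in> hom (ob_map D i) (ob_map D j)" if "(i, j) \<in> le" for i j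
    using D(2) that unfolding functor_poset_iff[OF po] by blast
  have t: "i \<in> I \<Longrightarrow> t i \<in> hom (ob_map D i) A" and tt: "(i, j) \<in> le \<Longrightarrow> t j \<cdot> ar_map D (i, j) = t i" for i j
    using D(4) unfolding colimit_poset_iff cocone_poset_iff by blast+
  have te: "t i \<in> elements A" "Dom K (t i) = ob_map D i" if "i \<in> I" for i
    using that t D(3) by (auto simp: elements_def Hom_def)
  have \<phi>t: "\<phi> (t i) \<in> hom (ob_map D i) B" if "i \<in> I" for i
    using \<phi>[OF te(1)[OF that]] te(2)[OF that] by (metis elements_iff)
  have "is_cocone (poset_cat I le) K D B (\<lambda>i. \<phi> (t i))"
    unfolding cocone_poset_iff
  proof (intro conjI ballI allI impI B \<phi>t)
    fix i j assume ij: "(i, j) \<in> le"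
    have d: "Dom K (ar_map D (i, j)) = ob_map D i" using ar[OF ij] by (simp add: Hom_def)
    have "\<phi> (t j \<cdot> ar_map D (i, j)) = \<phi> (t j) \<cdot> ar_map D (i, j)"
      by (rule nat) (use te le ij ar d D(3) in auto)
    then show "\<phi> (t j) \<cdot> ar_map D (i, j) = \<phi> (t i)" using tt[OF ij] by simp
  qed
  then obtain h where h: "h \<in> hom A B" "\<And>i. i \<in> I \<Longrightarrow> h \<cdot> t i = \<phi> (t i)"
    using colimit_obtain[OF D(4)] by blast
  \<comment> \<open>An element that is not a leg still factors through one, its source being
    presentable, and naturality along the factor \<open>z\<close> determines its image.\<close>
  have "h \<cdot> y = \<phi> y" if y: "y \<in> elements A" for y
  proof -
    have yS: "Dom K y \<in> S" and yh: "y \<in> hom (Dom K y) A" using y by (auto simp: elements_iff)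
    obtain i z where i: "i \<in> I" and z: "z \<in> hom (Dom K y) (ob_map D i)" "t i \<cdot> z = y"
      using presentable_compact_at[OF S_presentable[OF yS] D(1,2,4)] yh unfolding compact_at_def by blast
    have "Dom K z = Dom K y" using z(1) by (simp add: Hom_def)
    then have "\<phi> y = \<phi> (t i) \<cdot> z" using nat[OF te(1)[OF i], of z] z te(2)[OF i] yS by simp
    also have "\<dots> = h \<cdot> (t i \<cdot> z)" using h(2)[OF i] comp_assoc[OF h(1) t[OF i] z(1)] by simp
    finally show ?thesis using z by simp
  qed
  then show thesis using that h by blast
qed

text \<open>The presheaf of elements with its elements renamed by \<open>e\<close>. After renaming
  into a fixed set, the presheaves of different objects can be compared and counted as sets of
  triples.\<close>

definition action_graph :: "('a \<Rightarrow> 'b) \<Rightarrow> 'a \<Rightarrow> ('b \<times> 'a \<times> 'b) set" where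
  "action_graph e A = {(e y, u, e (y \<cdot> u)) | y u. y \<in> elements A \<and> u \<in> Arr K \<and> Dom K u \<in> S \<and> Cod K u = Dom K y}"

lemma action_graphI:
  "y \<in> elements A \<Longrightarrow> u \<in> Arr K \<Longrightarrow> Dom K u \<in> S \<Longrightarrow> Cod K u = Dom K y \<Longrightarrow> (e y, u, e (y \<cdot> u)) \<in> action_graph e A"
  unfolding action_graph_def by (rule CollectI, rule exI[of _ y], rule exI[of _ u]) simp

lemma action_graphE:
  assumes "(a, u, b) \<in> action_graph e A"
  obtains y where "y \<in> elements A" "u \<in> Arr K" "Dom K u \<in> S" "Cod K u = Dom K y" "a = e y" "b = e (y \<cdot> u)"
  using assms unfolding action_graph_def by (elim CollectE exE conjE) simp

lemma arrow_of_action_graph_subset: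
  assumes A: "A \<in> Obj K" and B: "B \<in> Obj K"
    and e: "inj_on e (elements A)" "inj_on e' (elements B)" and sub: "action_graph e A \<subseteq> action_graph e' B"
  obtains h where "h \<in> hom A B" "\<And>y. y \<in> elements A \<Longrightarrow> e' (h \<cdot> y) = e y"
proof -
  have "\<exists>y'\<in>elements B. e' y' = e y \<and> Dom K y' = Dom K y" if y: "y \<in> elements A" for y
  proof -
    have yS: "Dom K y \<in> S" and yh: "y \<in> hom (Dom K y) A" using y by (auto simp: elements_iff)
    have "Ident K (Dom K y) \<in> hom (Dom K y) (Dom K y)" using yh hom_dom ident_in by blast
    then have i: "Ident K (Dom K y) \<in> Arr K" "Dom K (Ident K (Dom K y)) = Dom K y"
      "Cod K (Ident K (Dom K y)) = Dom K y" by (auto simp: Hom_def)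
    \<comment> \<open>The triple of the identity shows that the label of \<open>y\<close> also
      occurs in \<open>B\<close>, and that it belongs there to an element with the same
      source.\<close>
    have "(e y, Ident K (Dom K y), e (y \<cdot> Ident K (Dom K y))) \<in> action_graph e A"
      by (rule action_graphI) (use y yS i in simp_all)
    then have "(e y, Ident K (Dom K y), e (y \<cdot> Ident K (Dom K y))) \<in> action_graph e' B" using sub by (rule subsetD[rotated])
    then obtain y' where "y' \<in> elements B" "e y = e' y'" "Cod K (Ident K (Dom K y)) = Dom K y'"
      by (rule action_graphE)
    then show ?thesis using i(3) by (intro bexI[of _ y']) simp_all
  qed
  then obtain \<phi> where \<phi>: "\<And>y. y \<in> elements A \<Longrightarrow> \<phi> y \<in> elements B \<and> e' (\<phi> y) = e y \<and> Dom K (\<phi> y) = Dom K y"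
    by metis
  have nat: "\<phi> (y \<cdot> u) = \<phi> y \<cdot> u" if y: "y \<in> elements A" and u: "u \<in> hom (Dom K u) (Dom K y)" and uS: "Dom K u \<in> S" for y u
  proof -
    have yh: "y \<in> hom (Dom K y) A" using y by (simp add: elements_iff)
    have ud: "u \<in> Arr K" "Cod K u = Dom K y" using u by (auto simp: Hom_def)
    have "y \<cdot> u \<in> hom (Dom K u) A" using comp_in[OF yh u] .
    then have yue: "y \<cdot> u \<in> elements A" using uS by (auto simp: elements_def Hom_def)
    have "(e y, u, e (y \<cdot> u)) \<in> action_graph e A" using action_graphI[OF y ud(1) uS ud(2)] .
    then have "(e y, u, e (y \<cdot> u)) \<in> action_graph e' B" using sub by (rule subsetD[rotated])
    then obtain y' where y': "y' \<in> elements B" "e y = e' y'" "e (y \<cdot> u) = e' (y' \<cdot> u)" "Cod K u = Dom K y'"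
      by (rule action_graphE)
    have "y' = \<phi> y" using y' \<phi>[OF y] e(2) by (metis inj_onD)
    have "\<phi> y \<in> hom (Dom K y) B" using \<phi>[OF y] by (metis elements_iff)
    then have "\<phi> y \<cdot> u \<in> hom (Dom K u) B" using comp_in u by blast
    then have "\<phi> y \<cdot> u \<in> elements B" using uS by (auto simp: elements_def Hom_def)
    moreover have "e' (\<phi> y \<cdot> u) = e' (\<phi> (y \<cdot> u))" using y' \<open>y' = \<phi> y\<close> \<phi>[OF yue] by simp
    ultimately show ?thesis using \<phi>[OF yue] e(2) by (metis inj_onD)
  qed
  obtain h where "h \<in> hom A B" "\<And>y. y \<in> elements A \<Longrightarrow> h \<cdot> y = \<phi> y"
    using arrow_of_natural_map[OF A B, of \<phi>] \<phi> nat by blast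
  then show thesis using that \<phi> by metis
qed

text \<open>The two inclusions give arrows that preserve labels. Labels being injective, the
  composites fix all elements, and elements are jointly epic.\<close>

lemma isomorphic_of_action_graph_eq:
  assumes A: "A \<in> Obj K" and B: "B \<in> Obj K"
    and e: "inj_on e (elements A)" "inj_on e' (elements B)" and eq: "action_graph e A = action_graph e' B"
  shows "isomorphic K A B"
proof -
  obtain h where h: "h \<in> hom A B" "\<And>y. y \<in> elements A \<Longrightarrow> e' (h \<cdot> y) = e y"
    using arrow_of_action_graph_subset[OF A B e] eq by blast
  obtain h' where h': "h' \<in> hom B A" "\<And>y. y \<in> elements B \<Longrightarrow> e (h' \<cdot> y) = e' y"
    using arrow_of_action_graph_subset[OF B A e(2,1)] eq by blast
  have "h' \<cdot> h = Ident K A"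
  proof (rule elements_jointly_epic[OF A comp_in[OF h'(1) h(1)] ident_in[OF A]])
    fix y assume y: "y \<in> elements A"
    then have yh: "y \<in> hom (Dom K y) A" by (simp add: elements_iff)
    have hy: "h \<cdot> y \<in> elements B" "h' \<cdot> (h \<cdot> y) \<in> elements A"
      using elements_comp[OF h(1) y] elements_comp[OF h'(1)] by blast+
    have "e (h' \<cdot> (h \<cdot> y)) = e y" using h(2)[OF y] h'(2)[OF hy(1)] by simp
    then have "h' \<cdot> (h \<cdot> y) = y" using e(1) hy y by (metis inj_onD)
    then show "(h' \<cdot> h) \<cdot> y = Ident K A \<cdot> y" using comp_assoc[OF h'(1) h(1) yh] yh by simp
  qed
  moreover have "h \<cdot> h' = Ident K B"
  proof (rule elements_jointly_epic[OF B comp_in[OF h(1) h'(1)] ident_in[OF B]])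
    fix y assume y: "y \<in> elements B"
    then have yh: "y \<in> hom (Dom K y) B" by (simp add: elements_iff)
    have hy: "h' \<cdot> y \<in> elements A" "h \<cdot> (h' \<cdot> y) \<in> elements B"
      using elements_comp[OF h'(1) y] elements_comp[OF h(1)] by blast+
    have "e' (h \<cdot> (h' \<cdot> y)) = e' y" using h'(2)[OF y] h(2)[OF hy(1)] by simp
    then have "h \<cdot> (h' \<cdot> y) = y" using e(2) hy y by (metis inj_onD)
    then show "(h \<cdot> h') \<cdot> y = Ident K B \<cdot> y" using comp_assoc[OF h(1) h'(1) yh] yh by simp
  qed
  ultimately show ?thesis using h h' by (intro isomorphicI)
qed

lemma is_small_S: "is_small S"
  using small_S by (simp add: small_def)

text \<open>Up to isomorphism, an object is determined by the action of \<open>S\<close> on its elements, and there is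
  only a small number of such actions on subsets of a fixed small set.\<close>

lemma small_isomorphism_classes:
  assumes T: "is_small T"
  obtains \<H> where "\<H> \<subseteq> Obj K" "is_small \<H>"
    "\<And>A. A \<in> Obj K \<Longrightarrow> |elements A| \<le>o |T| \<Longrightarrow> \<exists>B\<in>\<H>. isomorphic K A B"
proof -
  define X where "X = {A \<in> Obj K. |elements A| \<le>o |T|}"
  have "\<forall>A\<in>X. \<exists>e. inj_on e (elements A) \<and> e ` elements A \<subseteq> T"
    unfolding X_def by (auto simp: card_of_ordLeq)
  then obtain e where e: "\<And>A. A \<in> X \<Longrightarrow> inj_on (e A) (elements A) \<and> e A ` elements A \<subseteq> T" by metis
  let ?c = "\<lambda>A. action_graph (e A) A"
  let ?U = "{u \<in> Arr K. Dom K u \<in> S \<and> Cod K u \<in> S}"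
  have "?c A \<subseteq> T \<times> ?U \<times> T" if A: "A \<in> X" for A
  proof
    fix x assume "x \<in> ?c A"
    then obtain a u b where "x = (a, u, b)" "(a, u, b) \<in> ?c A" by (cases x) blast
    from this(2) obtain y where y: "y \<in> elements A" and u: "u \<in> Arr K" "Dom K u \<in> S" "Cod K u = Dom K y"
      and "a = e A y" "b = e A (y \<cdot> u)" by (rule action_graphE)
    then have x: "x = (e A y, u, e A (y \<cdot> u))" using \<open>x = _\<close> by simp
    have "y \<in> hom (Dom K y) A" using y by (simp add: elements_iff)
    then have "y \<cdot> u \<in> hom (Dom K u) A" by (rule comp_in) (use u in \<open>simp add: Hom_def\<close>)
    then have "y \<cdot> u \<in> elements A" using u by (auto simp: elements_def Hom_def)
    then show "x \<in> T \<times> ?U \<times> T" using x u y e[OF A] by (auto simp: elements_def)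
  qed
  then have "?c ` X \<subseteq> Pow (T \<times> ?U \<times> T)" by blast
  moreover have "is_small (Pow (T \<times> ?U \<times> T))"
    by (intro small_Pow small_Times T small_homs is_small_S)
  ultimately have sm: "is_small (?c ` X)" by (rule small_subset[rotated])
  show thesis
  proof
    show "is_small (inv_into X ?c ` ?c ` X)" using sm by (rule small_image)
    show "inv_into X ?c ` ?c ` X \<subseteq> Obj K"
      using inv_into_into[of _ ?c X] by (force simp: X_def)
    fix A assume "A \<in> Obj K" "|elements A| \<le>o |T|"
    then have A: "A \<in> X" by (simp add: X_def)
    let ?B = "inv_into X ?c (?c A)"
    have "?c A \<in> ?c ` X" using A by blast
    then have B: "?B \<in> X" "?c ?B = ?c A" by (rule inv_into_into, rule f_inv_into_f)
    have "isomorphic K A ?B"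
      by (rule isomorphic_of_action_graph_eq[of _ _ "e A" "e ?B"]) (use A B e in \<open>auto simp: X_def\<close>)
    then show "\<exists>B\<in>inv_into X ?c ` ?c ` X. isomorphic K A B" using A by blast
  qed
qed

text \<open>Otherwise a family of pairwise non-isomorphic objects that is not small would inject
  into a small set of representatives.\<close>

lemma large_unbounded:
  assumes "large K" and T: "is_small T"
  obtains A where "A \<in> Obj K" "\<not> |elements A| \<le>o |T|"
proof -
  obtain X where X: "X \<subseteq> Obj K" "\<not> small X"
    "\<And>M N. M \<in> X \<Longrightarrow> N \<in> X \<Longrightarrow> M \<noteq> N \<Longrightarrow> \<not> isomorphic K M N"
    using assms(1) unfolding large_def by blast
  obtain \<H> where H: "\<H> \<subseteq> Obj K" "is_small \<H>"
    "\<And>A. A \<in> Obj K \<Longrightarrow> |elements A| \<le>o |T| \<Longrightarrow> \<exists>B\<in>\<H>. isomorphic K A B"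
    using small_isomorphism_classes[OF T] by blast
  show thesis
  proof (rule ccontr)
    assume "\<not> thesis"
    then have "\<forall>A\<in>X. |elements A| \<le>o |T|" using that X(1) by blast
    then have "\<forall>A\<in>X. \<exists>B\<in>\<H>. isomorphic K A B" using H(3) X(1) by blast
    then obtain b where b: "\<And>A. A \<in> X \<Longrightarrow> b A \<in> \<H> \<and> isomorphic K A (b A)" by metis
    have "inj_on b X"
    proof (rule inj_onI, rule ccontr)
      fix M N assume MN: "M \<in> X" "N \<in> X" "b M = b N" "M \<noteq> N"
      have "isomorphic K M N"
        using b[OF MN(1)] b[OF MN(2)] MN(3) isomorphic_sym isomorphic_trans by metis
      then show False using X(3) MN by blast
    qed
    then have "|X| \<le>o |\<H>|" using b by (intro card_of_ordLeqI[of b]) auto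
    then have "is_small X" using H(2) small_ordLeq by blast
    then show False using X(2) by (simp add: small_def)
  qed
qed

end

section \<open>Solution sets\<close>

lemma regular_strict_upper_bound:
  assumes r: "Card_order r" "infinite (Field r)" "regularCard r" and A: "A \<subseteq> Field r" "|A| <o r"
  obtains b where "b \<in> Field r" "A \<subseteq> underS r b"
proof -
  have "Well_order r" using r(1) by (simp add: card_order_on_well_order_on)
  then have lin: "trans r" "antisym r" "Total r" "Refl r"
    by (auto simp: well_order_on_def linear_order_on_def partial_order_on_def preorder_on_def)
  have "\<not> cofinal A r"
  proof
    assume "cofinal A r"
    then have "|A| =o r" using r(3) A(1) unfolding regularCard_def by blast
    then show False using A(2) not_ordLess_ordIso by blast
  qed
  \<comment> \<open>Failure of cofinality gives only a weak bound \<open>a\<close>; passing to a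
    larger \<open>b\<close> makes it strict, as \<open>stage\<close> reads only strictly earlier
    stages.\<close>
  then obtain a where a: "a \<in> Field r" "\<And>x. x \<in> A \<Longrightarrow> a = x \<or> (a, x) \<notin> r"
    unfolding cofinal_def by blast
  obtain b where b: "b \<in> Field r" "a \<noteq> b" "(a, b) \<in> r"
    using infinite_Card_order_limit[OF r(1,2) a(1)] by blast
  have "x \<in> underS r b" if x: "x \<in> A" for x
  proof -
    have xF: "x \<in> Field r" using A(1) x by blast
    have xa: "(x, a) \<in> r"
    proof (cases "a = x")
      case True then show ?thesis using lin(4) a(1) by (simp add: refl_on_def)
    next
      case False then show ?thesis using a(2)[OF x] lin(3) a(1) xF by (auto simp: total_on_def)
    qed
    have "(x, b) \<in> r" using transD[OF lin(1) xa b(3)] .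
    moreover have "x \<noteq> b" using antisymD[OF lin(2) xa] b(2,3) by auto
    ultimately show ?thesis by (simp add: underS_def)
  qed
  then show thesis using that b(1) by blast
qed

text \<open>Transfinite iteration along \<open>r\<close> of adjoining \<open>f Z\<close> for all subsets \<open>Z\<close> of size \<open>< r\<close>, starting
  from \<open>X\<close>.\<close>

inductive stage :: "'a rel \<Rightarrow> 'b set \<Rightarrow> ('b set \<Rightarrow> 'b) \<Rightarrow> 'a \<Rightarrow> 'b \<Rightarrow> bool" for r X f where
  stage_base: "x \<in> X \<Longrightarrow> stage r X f a x"
| stage_step: "|Z| <o r \<Longrightarrow> (\<And>z. z \<in> Z \<Longrightarrow> \<exists>b\<in>underS r a. stage r X f b z) \<Longrightarrow> stage r X f a (f Z)"

text \<open>Induction along \<open>r\<close>: a new member is the value of \<open>f\<close> at a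
  subset of size \<open>< r\<close> of the union of the earlier stages, and there are at most
  \<open>|Pow B|\<close> such subsets. The bound \<open>|B|\<close> would in general not survive
  this step.\<close>

lemma card_stage:
  assumes r: "Card_order r" "r \<le>o |B|" and B: "infinite B" and X: "|X| \<le>o |Pow B|" and a: "a \<in> Field r"
  shows "|{x. stage r X f a x}| \<le>o |Pow B|"
proof -
  have "Well_order r" using r(1) by (simp add: card_order_on_well_order_on)
  then have wf: "wf (r - Id)" by (simp add: well_order_on_def)
  have PB: "infinite (Pow B)" using B by simp
  have BP: "|B| \<le>o |Pow B|" using card_of_Pow ordLess_imp_ordLeq by blast
  have "|Field r| =o r" using r(1) card_of_Field_ordIso by blast
  then have rB: "|Field r| \<le>o |Pow B|" using r(2) BP ordIso_ordLeq_trans ordLeq_transitive by blast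
  show ?thesis using a
  proof (induction a rule: wf_induct_rule[OF wf])
    case (1 a)
    let ?Y = "\<Union>b\<in>underS r a. {x. stage r X f b x}"
    have sub: "underS r a \<subseteq> Field r" by (auto simp: underS_def Field_def)
    have "|{x. stage r X f b x}| \<le>o |Pow B|" if "b \<in> underS r a" for b
      using 1(1)[of b] that sub by (auto simp: underS_def)
    moreover have "|underS r a| \<le>o |Pow B|" using card_of_mono1[OF sub] rB ordLeq_transitive by blast
    ultimately have Y: "|?Y| \<le>o |Pow B|"
      using PB by (intro card_of_UNION_ordLeq_infinite) auto
    have "{x. stage r X f a x} \<subseteq> X \<union> f ` {Z. Z \<subseteq> ?Y \<and> |Z| <o r}"
    proof
      fix x assume "x \<in> {x. stage r X f a x}"
      then have "stage r X f a x" by simp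
      then show "x \<in> X \<union> f ` {Z. Z \<subseteq> ?Y \<and> |Z| <o r}"
      proof cases
        case (stage_step Z)
        then have "Z \<in> {Z. Z \<subseteq> ?Y \<and> |Z| <o r}" by blast
        then show ?thesis using stage_step by blast
      qed simp
    qed
    moreover have "|f ` {Z. Z \<subseteq> ?Y \<and> |Z| <o r}| \<le>o |Pow B|"
      using card_bounded_subsets[OF Y B r] card_of_image ordLeq_transitive by blast
    then have "|X \<union> f ` {Z. Z \<subseteq> ?Y \<and> |Z| <o r}| \<le>o |Pow B|"
      using X PB by (intro card_of_Un_ordLeq_infinite_Field) (auto simp: Field_card_of card_of_card_order_on)
    ultimately show ?case using card_of_mono1 ordLeq_transitive by blast
  qed
qed

text \<open>Iteration along \<open>\<mu>\<close> reaches a directed set: by regularity, the members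
  of a subset of size \<open>< \<mu>\<close> all appear before a common index, where a bound for
  them is adjoined.\<close>

lemma directed_subposet:
  fixes \<mu> :: "'v rel"
  assumes P: "directed_poset \<mu> I le" and mu: "small_regular \<mu>"
    and B: "infinite B" "\<mu> \<le>o |B|" and X: "X \<subseteq> I" "|X| \<le>o |Pow B|"
  obtains I' where "X \<subseteq> I'" "I' \<subseteq> I" "|I'| \<le>o |Pow B|" "directed_poset \<mu> I' (le \<inter> I' \<times> I')"
proof -
  have r: "Card_order \<mu>" "infinite (Field \<mu>)" "regularCard \<mu>"
    using mu by (auto simp: small_regular_def small_cardinal_def cinfinite_def)
  define f where "f Z = (SOME b. b \<in> I \<and> (\<forall>s\<in>Z. (s, b) \<in> le))" for Z
  have f: "f Z \<in> I \<and> (\<forall>s\<in>Z. (s, f Z) \<in> le)" if "Z \<subseteq> I" "|Z| <o \<mu>" for Z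
    unfolding f_def by (rule someI_ex) (use P that in \<open>auto simp: directed_poset_def\<close>)
  define I' where "I' = (\<Union>a\<in>Field \<mu>. {x. stage \<mu> X f a x})"
  have "x \<in> I" if "stage \<mu> X f a x" for a x
    using that by induction (use X(1) f in blast)+
  then have I'I: "I' \<subseteq> I" by (auto simp: I'_def)
  have BP: "|B| \<le>o |Pow B|" using card_of_Pow ordLess_imp_ordLeq by blast
  have "|Field \<mu>| =o \<mu>" using r(1) card_of_Field_ordIso by blast
  then have rB: "|Field \<mu>| \<le>o |Pow B|" using B(2) BP ordIso_ordLeq_trans ordLeq_transitive by blast
  have c: "|I'| \<le>o |Pow B|"
    unfolding I'_def using B(1) rB card_stage[OF r(1) B(2,1) X(2)]
    by (intro card_of_UNION_ordLeq_infinite) auto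
  obtain a0 where a0: "a0 \<in> Field \<mu>" using r(2) by (metis finite.emptyI ex_in_conv)
  have XI': "X \<subseteq> I'"
  proof
    fix x assume "x \<in> X"
    then have "stage \<mu> X f a0 x" by (rule stage_base)
    then show "x \<in> I'" using a0 unfolding I'_def by blast
  qed
  have "directed_poset \<mu> I' (le \<inter> I' \<times> I')"
    unfolding directed_poset_def
  proof (intro conjI allI impI)
    have "small I" using P by (simp add: directed_poset_def)
    then show "small I'" using ordLeq_ordLess_trans[OF card_of_mono1[OF I'I]] by (simp add: small_def)
    have "partial_order_on I le" using P by (simp add: directed_poset_def)
    then show "partial_order_on I' (le \<inter> I' \<times> I')"
      using I'I unfolding partial_order_on_def preorder_on_def refl_on_def trans_def antisym_def by fast
    fix Z assume Z: "Z \<subseteq> I'" "|Z| <o \<mu>"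
    then have "\<forall>z\<in>Z. \<exists>a\<in>Field \<mu>. stage \<mu> X f a z" unfolding I'_def by blast
    then obtain a where a: "\<And>z. z \<in> Z \<Longrightarrow> a z \<in> Field \<mu> \<and> stage \<mu> X f (a z) z" by metis
    have "|a ` Z| <o \<mu>" using Z(2) card_of_image ordLeq_ordLess_trans by blast
    then obtain b where b: "b \<in> Field \<mu>" "a ` Z \<subseteq> underS \<mu> b"
      using regular_strict_upper_bound[OF r, of "a ` Z"] a by blast
    have "stage \<mu> X f b (f Z)"
      by (rule stage_step[OF Z(2)]) (use a b(2) in blast)
    then have "f Z \<in> I'" using b(1) unfolding I'_def by blast
    moreover have "\<forall>s\<in>Z. (s, f Z) \<in> le" using f[of Z] Z I'I by blast
    ultimately show "\<exists>b\<in>I'. \<forall>s\<in>Z. (s, b) \<in> le \<inter> I' \<times> I'" using Z(1) by blast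
  qed
  then show thesis using that XI' I'I c by blast
qed

context accessible_category
begin

text \<open>In a presentation of \<open>P\<close> as a directed colimit of objects of
  \<open>S\<close>, the members of \<open>F\<close> factor through at most \<open>|B|\<close>
  stages. The colimit of a directed subdiagram containing these stages is the required
  \<open>A\<close>. The bound on its elements mentions neither \<open>P\<close> nor
  \<open>F\<close>.\<close>

lemma solution_set:
  fixes B :: "'b set"
  assumes B: "infinite B" "\<mu> \<le>o |B|" and P: "P \<in> Obj K" and F: "F \<subseteq> elements P" "|F| \<le>o |B|"
  obtains A a where "A \<in> Obj K" "|elements A| \<le>o |Pow B \<times> {u \<in> Arr K. Dom K u \<in> S \<and> Cod K u \<in> S}|"
    "a \<in> hom A P" "\<And>y. y \<in> F \<Longrightarrow> \<exists>z\<in>hom (Dom K y) A. a \<cdot> z = y"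
proof -
  let ?U = "{u \<in> Arr K. Dom K u \<in> S \<and> Cod K u \<in> S}"
  obtain I le D t where D: "directed_poset \<mu> I le" "is_functor (poset_cat I le) K D"
    "\<And>i. i \<in> I \<Longrightarrow> ob_map D i \<in> S" "is_colimit (poset_cat I le) K D P t"
    using colimit_of_representatives[OF P] by blast
  have "\<exists>i\<in>I. \<exists>z\<in>hom (Dom K y) (ob_map D i). t i \<cdot> z = y" if y: "y \<in> F" for y
  proof -
    have yS: "Dom K y \<in> S" and yh: "y \<in> hom (Dom K y) P" using y F(1) elements_iff by blast+
    then show ?thesis
      using presentable_compact_at[OF S_presentable[OF yS] D(1,2,4)] unfolding compact_at_def by blast
  qed
  then obtain i where i: "\<And>y. y \<in> F \<Longrightarrow> i y \<in> I \<and> (\<exists>z\<in>hom (Dom K y) (ob_map D (i y)). t (i y) \<cdot> z = y)"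
    by metis
  have "|i ` F| \<le>o |Pow B|"
    using F(2) card_of_image card_of_Pow ordLess_imp_ordLeq ordLeq_transitive by metis
  moreover have "i ` F \<subseteq> I" using i by blast
  ultimately obtain I' where I': "i ` F \<subseteq> I'" "I' \<subseteq> I" "|I'| \<le>o |Pow B|"
    "directed_poset \<mu> I' (le \<inter> I' \<times> I')"
    using directed_subposet[OF D(1) mu B] by blast
  let ?le = "le \<inter> I' \<times> I'"
  have po: "partial_order_on I le" "partial_order_on I' ?le" using D(1) I'(4) by (simp_all add: directed_poset_def)
  have D': "is_functor (poset_cat I' ?le) K D"
    using D(2) I'(2) unfolding functor_poset_iff[OF po(1)] functor_poset_iff[OF po(2)] by blast
  obtain A t' where A: "is_colimit (poset_cat I' ?le) K D A t'"
    using directed_colimits D' I'(4) unfolding has_directed_colimits_def by blast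
  have AO: "A \<in> Obj K" and t': "\<And>j. j \<in> I' \<Longrightarrow> t' j \<in> hom (ob_map D j) A"
    using A unfolding colimit_poset_iff cocone_poset_iff by blast+
  have "is_cocone (poset_cat I' ?le) K D P t"
    using D(4) I'(2) unfolding colimit_poset_iff cocone_poset_iff by blast
  then obtain a where a: "a \<in> hom A P" "\<And>j. j \<in> I' \<Longrightarrow> a \<cdot> t' j = t j"
    using colimit_obtain[OF A] by blast
  show thesis
  proof (rule that[OF AO _ a(1)])
    \<comment> \<open>Sources of elements are presentable, so each element of \<open>A\<close> is
      recorded by a stage and an arrow inside \<open>S\<close> into it.\<close>
    have "elements A \<subseteq> (\<lambda>(j, z). t' j \<cdot> z) ` (I' \<times> ?U)"
    proof
      fix y assume y: "y \<in> elements A"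
      then have yS: "Dom K y \<in> S" and yh: "y \<in> hom (Dom K y) A" using elements_iff by blast+
      then obtain j z where jz: "j \<in> I'" "z \<in> hom (Dom K y) (ob_map D j)" "t' j \<cdot> z = y"
        using presentable_compact_at[OF S_presentable[OF yS] I'(4) D' A] unfolding compact_at_def by blast
      have "ob_map D j \<in> S" using D(3) I'(2) jz(1) by blast
      then have "z \<in> ?U" using jz(2) yS by (auto simp: Hom_def)
      then show "y \<in> (\<lambda>(j, z). t' j \<cdot> z) ` (I' \<times> ?U)" using jz by force
    qed
    then have "|elements A| \<le>o |I' \<times> ?U|" by (rule in_ordLeq_card)
    then show "|elements A| \<le>o |Pow B \<times> ?U|" using card_of_Times_mono1[OF I'(3)] ordLeq_transitive by blast
    fix y assume y: "y \<in> F"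
    then obtain z where z: "z \<in> hom (Dom K y) (ob_map D (i y))" "t (i y) \<cdot> z = y" using i by blast
    have iy: "i y \<in> I'" using I'(1) y by blast
    have "t' (i y) \<cdot> z \<in> hom (Dom K y) A" using t'[OF iy] z comp_in by blast
    moreover have "a \<cdot> (t' (i y) \<cdot> z) = y" using comp_assoc[OF a(1) t'[OF iy] z(1)] a(2)[OF iy] z(2) by simp
    ultimately show "\<exists>z\<in>hom (Dom K y) A. a \<cdot> z = y" by blast
  qed
qed

end

section \<open>Dependence of presentability on the cardinal\<close>

context small_hom_category
begin

lemma directed_mono: "directed_poset \<rho> I le \<Longrightarrow> \<sigma> \<le>o \<rho> \<Longrightarrow> directed_poset \<sigma> I le"
  unfolding directed_poset_def using ordLess_ordLeq_trans by blast

lemma presentable_mono: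
  assumes \<sigma>: "small_regular \<sigma>" and \<rho>: "small_regular \<rho>" "\<sigma> \<le>o \<rho>" and M: "presentable K \<sigma> M"
  shows "presentable K \<rho> M"
proof -
  note M' = M[unfolded presentable_iff[OF \<sigma>]]
  show ?thesis
    unfolding presentable_iff[OF \<rho>(1)]
    using conjunct1[OF M'] conjunct2[OF M', rule_format, OF directed_mono[OF _ \<rho>(2)]] by blast
qed

end

section \<open>Hulls\<close>

locale multipresentable_category = accessible_category +
  assumes connected_limits: "has_connected_limits K"
begin

text \<open>The family \<open>f\<close> is initial in its component of the category of objects equipped with an
  \<open>X\<close>-indexed family of elements; phrased without reference to other objects of the component.\<close>

definition generated :: "'i set \<Rightarrow> ('i \<Rightarrow> 'a) \<Rightarrow> 'a \<Rightarrow> bool" where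
  "generated X f H \<longleftrightarrow> H \<in> Obj K \<and> (\<forall>x\<in>X. f x \<in> elements H) \<and>
     (\<forall>P m p. m \<in> hom P H \<longrightarrow> (\<forall>x\<in>X. p x \<in> hom (Dom K (f x)) P \<and> m \<cdot> p x = f x) \<longrightarrow>
        (\<exists>s\<in>hom H P. m \<cdot> s = Ident K H \<and> (\<forall>x\<in>X. s \<cdot> f x = p x)))"

lemma generated_obj: "generated X f H \<Longrightarrow> H \<in> Obj K"
  and generated_elements: "generated X f H \<Longrightarrow> x \<in> X \<Longrightarrow> f x \<in> elements H"
  and generated_hom: "generated X f H \<Longrightarrow> x \<in> X \<Longrightarrow> f x \<in> hom (Dom K (f x)) H"
  by (simp_all add: generated_def elements_iff)

lemma generated_section:
  assumes "generated X f H" "m \<in> hom P H"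
    "\<And>x. x \<in> X \<Longrightarrow> p x \<in> hom (Dom K (f x)) P \<and> m \<cdot> p x = f x"
  obtains s where "s \<in> hom H P" "m \<cdot> s = Ident K H" "\<And>x. x \<in> X \<Longrightarrow> s \<cdot> f x = p x"
  using assms unfolding generated_def by blast

text \<open>The family lifts to the equalizer of \<open>h\<close> and \<open>h'\<close>, whose arrow
  to \<open>H\<close> therefore has a section.\<close>

lemma generated_unique:
  assumes H: "generated X f H" and h: "h \<in> hom H L" "h' \<in> hom H L"
    and eq: "\<And>x. x \<in> X \<Longrightarrow> h \<cdot> f x = h' \<cdot> f x"
  shows "h = h'"
proof -
  obtain P m where m: "m \<in> hom P H" "h \<cdot> m = h' \<cdot> m"
    and um: "\<And>c p. p \<in> hom c H \<Longrightarrow> h \<cdot> p = h' \<cdot> p \<Longrightarrow> \<exists>k\<in>hom c P. m \<cdot> k = p"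
    by (rule equalizer[OF connected_limits h]) (rule that, assumption+)
  have "\<exists>k\<in>hom (Dom K (f x)) P. m \<cdot> k = f x" if "x \<in> X" for x
    using um[OF generated_hom[OF H that] eq[OF that]] .
  then obtain p where "\<And>x. x \<in> X \<Longrightarrow> p x \<in> hom (Dom K (f x)) P \<and> m \<cdot> p x = f x" by metis
  then obtain s where s: "s \<in> hom H P" "m \<cdot> s = Ident K H" using generated_section[OF H m(1)] by blast
  have "h = (h \<cdot> m) \<cdot> s" using comp_assoc[OF h(1) m(1) s(1)] s(2) h(1) by simp
  also have "\<dots> = h'" using comp_assoc[OF h(2) m(1) s(1)] s(2) h(2) m(2) by simp
  finally show ?thesis .
qed

text \<open>Initiality of the hull among the objects over \<open>N\<close> with a lift of the
  family. The families in \<open>H\<close> and \<open>B\<close> combine to one in the pullback of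
  \<open>n\<close> and \<open>b\<close>; the resulting section is composed with the projection to
  \<open>B\<close>.\<close>

lemma generated_extend:
  assumes H: "generated X f H" and n: "n \<in> hom H N" and b: "b \<in> hom B N"
    and g: "\<And>x. x \<in> X \<Longrightarrow> g x \<in> hom (Dom K (f x)) B \<and> b \<cdot> g x = n \<cdot> f x"
  obtains s where "s \<in> hom H B" "b \<cdot> s = n" "\<And>x. x \<in> X \<Longrightarrow> s \<cdot> f x = g x"
proof -
  obtain P p q where p: "p \<in> hom P H" "q \<in> hom P B" "n \<cdot> p = b \<cdot> q"
    and up: "\<And>c p' q'. p' \<in> hom c H \<Longrightarrow> q' \<in> hom c B \<Longrightarrow> n \<cdot> p' = b \<cdot> q' \<Longrightarrow>
       \<exists>h\<in>hom c P. p \<cdot> h = p' \<and> q \<cdot> h = q'"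
    by (rule pullback[OF connected_limits n b]) (rule that, assumption+)
  have "\<exists>h\<in>hom (Dom K (f x)) P. p \<cdot> h = f x \<and> q \<cdot> h = g x" if x: "x \<in> X" for x
    using up[OF generated_hom[OF H x], of "g x"] g[OF x] by simp
  then obtain e where e: "\<And>x. x \<in> X \<Longrightarrow> e x \<in> hom (Dom K (f x)) P \<and> p \<cdot> e x = f x \<and> q \<cdot> e x = g x" by metis
  then obtain s where s: "s \<in> hom H P" "p \<cdot> s = Ident K H" "\<And>x. x \<in> X \<Longrightarrow> s \<cdot> f x = e x"
    using generated_section[OF H p(1), of e] by blast
  have "b \<cdot> (q \<cdot> s) = n \<cdot> (p \<cdot> s)" using comp_assoc[OF b p(2) s(1)] comp_assoc[OF n p(1) s(1)] p(3) by simp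
  then have "b \<cdot> (q \<cdot> s) = n" using s(2) n by simp
  moreover have "(q \<cdot> s) \<cdot> f x = g x" if x: "x \<in> X" for x
    using comp_assoc[OF p(2) s(1) generated_hom[OF H x]] s(3)[OF x] e[OF x] by simp
  ultimately show thesis using that comp_in[OF p(2) s(1)] by blast
qed

text \<open>Each generator has a \<open>\<mu>\<close>-presentable source and is dealt with at some
  stage, and fewer than \<open>\<rho>\<close> stages have a common bound. There
  \<open>generated_extend\<close> assembles the factorizations of the generators, and
  \<open>generated_unique\<close> their identifications.\<close>

lemma generated_presentable:
  assumes H: "generated X f H" and \<rho>: "small_regular \<rho>" "\<mu> \<le>o \<rho>" and X: "|X| <o \<rho>"
  shows "presentable K \<rho> H"
  unfolding presentable_iff[OF \<rho>(1)]
proof (intro conjI allI impI)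
  show "H \<in> Obj K" using H by (rule generated_obj)
  fix I le D c t
  assume P: "directed_poset \<rho> I le" and D: "is_functor (poset_cat I le) K D"
    and col: "is_colimit (poset_cat I le) K D c t"
  have P': "directed_poset \<mu> I le" using P \<rho>(2) by (rule directed_mono)
  have po: "partial_order_on I le" using P by (simp add: directed_poset_def)
  have le: "i \<in> I" "j \<in> I" if "(i, j) \<in> le" for i j
    using po that by (auto simp: partial_order_on_def preorder_on_def)
  have trans: "(i, j) \<in> le \<Longrightarrow> (j, k) \<in> le \<Longrightarrow> (i, k) \<in> le" for i j k
    using po by (auto simp: partial_order_on_def preorder_on_def trans_def)
  have ar: "ar_map D (i, j) \<in> hom (ob_map D i) (ob_map D j)" if "(i, j) \<in> le" for i j
    using D that unfolding functor_poset_iff[OF po] by blast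
  have arc: "ar_map D (i, k) = ar_map D (j, k) \<cdot> ar_map D (i, j)" if "(i, j) \<in> le" "(j, k) \<in> le" for i j k
    using D that unfolding functor_poset_iff[OF po] by blast
  have t: "i \<in> I \<Longrightarrow> t i \<in> hom (ob_map D i) c" and tt: "(i, j) \<in> le \<Longrightarrow> t j \<cdot> ar_map D (i, j) = t i" for i j
    using col unfolding colimit_poset_iff cocone_poset_iff by blast+
  have bound: "\<exists>b\<in>I. \<forall>x\<in>X. (i x, b) \<in> le" if "\<And>x. x \<in> X \<Longrightarrow> i x \<in> I" for i
  proof -
    have "|i ` X| <o \<rho>" using X card_of_image ordLeq_ordLess_trans by blast
    moreover have "i ` X \<subseteq> I" using that by blast
    ultimately obtain b where "b \<in> I" "\<forall>s\<in>i ` X. (s, b) \<in> le"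
      using conjunct2[OF conjunct2[OF P[unfolded directed_poset_def]], rule_format] by (metis (no_types))
    then show ?thesis by (intro bexI[of _ b]) auto
  qed
  have comp: "compact_at I le D c t (Dom K (f x))" if "x \<in> X" for x
    using presentable_compact_at[OF S_presentable P' D col] generated_elements[OF H that] elements_iff by blast
  show "compact_at I le D c t H"
    unfolding compact_at_def
  proof (intro conjI ballI impI)
    fix h assume h: "h \<in> hom H c"
    have "\<exists>i\<in>I. \<exists>z\<in>hom (Dom K (f x)) (ob_map D i). t i \<cdot> z = h \<cdot> f x" if x: "x \<in> X" for x
      using comp[OF x] comp_in[OF h generated_hom[OF H x]] unfolding compact_at_def by blast
    then obtain i z where iz: "\<And>x. x \<in> X \<Longrightarrow> i x \<in> I \<and> z x \<in> hom (Dom K (f x)) (ob_map D (i x)) \<and> t (i x) \<cdot> z x = h \<cdot> f x"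
      by metis
    obtain b where b: "b \<in> I" "\<And>x. x \<in> X \<Longrightarrow> (i x, b) \<in> le" using bound[of i] iz by blast
    have "ar_map D (i x, b) \<cdot> z x \<in> hom (Dom K (f x)) (ob_map D b) \<and> t b \<cdot> (ar_map D (i x, b) \<cdot> z x) = h \<cdot> f x"
      if x: "x \<in> X" for x
    proof -
      note zx = iz[OF x]
      have "t b \<cdot> (ar_map D (i x, b) \<cdot> z x) = (t b \<cdot> ar_map D (i x, b)) \<cdot> z x"
        using comp_assoc[OF t[OF b(1)] ar[OF b(2)[OF x]]] zx by metis
      then show ?thesis using tt[OF b(2)[OF x]] zx comp_in[OF ar[OF b(2)[OF x]]] by simp
    qed
    then obtain s where "s \<in> hom H (ob_map D b)" "t b \<cdot> s = h"
      using generated_extend[OF H h t[OF b(1)], of "\<lambda>x. ar_map D (i x, b) \<cdot> z x"] by blast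
    then show "\<exists>i\<in>I. \<exists>g\<in>hom H (ob_map D i). t i \<cdot> g = h" using b(1) by blast
  next
    fix i g g' assume i: "i \<in> I" and g: "g \<in> hom H (ob_map D i)" "g' \<in> hom H (ob_map D i)"
      and eq: "t i \<cdot> g = t i \<cdot> g'"
    have "\<exists>j. (i, j) \<in> le \<and> ar_map D (i, j) \<cdot> (g \<cdot> f x) = ar_map D (i, j) \<cdot> (g' \<cdot> f x)" if x: "x \<in> X" for x
    proof -
      note fx = generated_hom[OF H x]
      have "t i \<cdot> (g \<cdot> f x) = t i \<cdot> (g' \<cdot> f x)"
        using comp_assoc[OF t[OF i] g(1) fx] comp_assoc[OF t[OF i] g(2) fx] eq by simp
      then show ?thesis using comp[OF x] i comp_in[OF g(1) fx] comp_in[OF g(2) fx] unfolding compact_at_def by blast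
    qed
    then obtain j where j: "\<And>x. x \<in> X \<Longrightarrow> (i, j x) \<in> le \<and> ar_map D (i, j x) \<cdot> (g \<cdot> f x) = ar_map D (i, j x) \<cdot> (g' \<cdot> f x)"
      by metis
    obtain b where b: "b \<in> I" "\<And>x. x \<in> X \<Longrightarrow> (j x, b) \<in> le" using bound[of j] j le by blast
    \<comment> \<open>If \<open>X\<close> is empty, \<open>b\<close> is an arbitrary stage and need
      not lie above \<open>i\<close>; hence a further stage above both.\<close>
    obtain k where k: "(i, k) \<in> le" "(b, k) \<in> le" using directed_pair[OF P \<rho>(1) i b(1)] by blast
    have "(ar_map D (i, k) \<cdot> g) \<cdot> f x = (ar_map D (i, k) \<cdot> g') \<cdot> f x" if x: "x \<in> X" for x
    proof -
      note fx = generated_hom[OF H x]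
      have jk: "(j x, k) \<in> le" using trans[OF b(2)[OF x] k(2)] .
      have ij: "(i, j x) \<in> le" using j[OF x] by blast
      have "(ar_map D (i, k) \<cdot> v) \<cdot> f x = ar_map D (j x, k) \<cdot> (ar_map D (i, j x) \<cdot> (v \<cdot> f x))"
        if v: "v \<in> hom H (ob_map D i)" for v
        using comp_assoc[OF ar[OF k(1)] v fx] comp_assoc[OF ar[OF jk] ar[OF ij] comp_in[OF v fx]] arc[OF ij jk]
        by simp
      then show ?thesis using g j[OF x] by simp
    qed
    then have "ar_map D (i, k) \<cdot> g = ar_map D (i, k) \<cdot> g'"
      by (rule generated_unique[OF H comp_in[OF ar[OF k(1)] g(1)] comp_in[OF ar[OF k(1)] g(2)]])
    then show "\<exists>j. (i, j) \<in> le \<and> ar_map D (i, j) \<cdot> g = ar_map D (i, j) \<cdot> g'" using k(1) by blast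
  qed
qed

text \<open>The hull is the limit of all objects over \<open>N\<close> from a solution set to which the family lifts.  Adding
  \<open>N\<close> itself to the diagram makes it connected.\<close>

lemma hull_exists:
  fixes B :: "'b set" and X :: "'i set"
  assumes B: "is_small B" "infinite B" "\<mu> \<le>o |B|" and N: "N \<in> Obj K"
    and X: "|X| \<le>o |B|" and f: "\<And>x. x \<in> X \<Longrightarrow> f x \<in> elements N"
  obtains H k g where "k \<in> hom H N" "generated X g H" "\<And>x. x \<in> X \<Longrightarrow> g x \<in> hom (Dom K (f x)) H \<and> k \<cdot> g x = f x"
proof -
  let ?U = "{u \<in> Arr K. Dom K u \<in> S \<and> Cod K u \<in> S}"
  have fh: "f x \<in> hom (Dom K (f x)) N" and fS: "Dom K (f x) \<in> S" if "x \<in> X" for x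
    using f[OF that] elements_iff by blast+
  have "is_small (Pow B \<times> ?U)" by (intro small_Times small_Pow B(1) small_homs is_small_S)
  then obtain \<H> where H: "\<H> \<subseteq> Obj K" "is_small \<H>"
    "\<And>A. A \<in> Obj K \<Longrightarrow> |elements A| \<le>o |Pow B \<times> ?U| \<Longrightarrow> \<exists>A'\<in>\<H>. isomorphic K A A'"
    using small_isomorphism_classes by blast
  \<comment> \<open>Weak initiality of the small set \<open>\<H>\<close>. It is stated over every
    \<open>P\<close> to which the family lifts, and not just over \<open>N\<close>.\<close>
  have sol: "\<exists>A\<in>\<H>. \<exists>a\<in>hom A P. \<exists>g. \<forall>x\<in>X. g x \<in> hom (Dom K (f x)) A \<and> a \<cdot> g x = p x"
    if P: "P \<in> Obj K" and p: "\<And>x. x \<in> X \<Longrightarrow> p x \<in> hom (Dom K (f x)) P" for P p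
  proof -
    have dp: "Dom K (p x) = Dom K (f x)" if "x \<in> X" for x using p[OF that] by (simp add: Hom_def)
    have "p ` X \<subseteq> elements P" using p fS by (auto simp: elements_def Hom_def)
    moreover have "|p ` X| \<le>o |B|" using X card_of_image ordLeq_transitive by blast
    ultimately obtain A a where A: "A \<in> Obj K" "|elements A| \<le>o |Pow B \<times> ?U|" "a \<in> hom A P"
      "\<And>y. y \<in> p ` X \<Longrightarrow> \<exists>z\<in>hom (Dom K y) A. a \<cdot> z = y"
      using solution_set[OF B(2,3) P] by blast
    have "\<exists>z\<in>hom (Dom K (f x)) A. a \<cdot> z = p x" if x: "x \<in> X" for x
      using A(4)[of "p x"] x dp[OF x] by auto
    then obtain z where z: "\<And>x. x \<in> X \<Longrightarrow> z x \<in> hom (Dom K (f x)) A \<and> a \<cdot> z x = p x" by metis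
    obtain A' where A': "A' \<in> \<H>" "isomorphic K A A'" using H(3)[OF A(1,2)] by blast
    obtain u v where uv: "u \<in> hom A A'" "v \<in> hom A' A" "v \<cdot> u = Ident K A" using A'(2) by (rule isomorphicE)
    have "u \<cdot> z x \<in> hom (Dom K (f x)) A' \<and> (a \<cdot> v) \<cdot> (u \<cdot> z x) = p x" if x: "x \<in> X" for x
    proof -
      have zx: "z x \<in> hom (Dom K (f x)) A" using z[OF x] by simp
      have "(a \<cdot> v) \<cdot> (u \<cdot> z x) = a \<cdot> ((v \<cdot> u) \<cdot> z x)"
        using comp_assoc[OF A(3) uv(2) comp_in[OF uv(1) zx]] comp_assoc[OF uv(2,1) zx] by simp
      then show ?thesis using uv(3) ident_comp[OF zx] z[OF x] comp_in[OF uv(1) zx] by simp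
    qed
    then show ?thesis using A'(1) comp_in[OF A(3) uv(2)] by (intro bexI exI ballI) auto
  qed
  \<comment> \<open>A vertex carries its lift as well as its arrow to \<open>N\<close>, since one
    object may admit several lifts. Lifts are taken in the extensional product so that
    \<open>W\<close> is small.\<close>
  define W where "W = {(A, g, a). A \<in> insert N \<H> \<and> a \<in> hom A N \<and>
     g \<in> (\<Pi>\<^sub>E x\<in>X. hom (Dom K (f x)) A) \<and> (\<forall>x\<in>X. a \<cdot> g x = f x)}"
  define ob :: "'a \<times> ('i \<Rightarrow> 'a) \<times> 'a \<Rightarrow> 'a" where "ob = fst"
  define gen :: "'a \<times> ('i \<Rightarrow> 'a) \<times> 'a \<Rightarrow> 'i \<Rightarrow> 'a" where "gen w = fst (snd w)" for w
  define str :: "'a \<times> ('i \<Rightarrow> 'a) \<times> 'a \<Rightarrow> 'a" where "str w = snd (snd w)" for w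
  define R where "R = {(w, u, w'). w \<in> W \<and> w' \<in> W \<and> u \<in> hom (ob w) (ob w') \<and>
     (\<forall>x\<in>X. u \<cdot> gen w x = gen w' x) \<and> str w' \<cdot> u = str w}"
  have Wo: "ob w \<in> Obj K" and Ws: "str w \<in> hom (ob w) N" if "w \<in> W" for w
    using that hom_dom by (auto simp: W_def ob_def str_def)
  have Wg: "gen w x \<in> hom (Dom K (f x)) (ob w)" and Wsg: "str w \<cdot> gen w x = f x" if "w \<in> W" "x \<in> X" for w x
    using that by (auto simp: W_def ob_def str_def gen_def)
  have "is_small X" using X B(1) small_ordLeq by blast
  then have "is_small (SIGMA A:insert N \<H>. (\<Pi>\<^sub>E x\<in>X. hom (Dom K (f x)) A) \<times> hom A N)"
    by (intro small_Sigma small_Times small_PiE small_hom small_insert H(2))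
  then have Wsmall: "is_small W" by (rule small_subset) (auto simp: W_def)
  define z where "z = (N, restrict f X, Ident K N)"
  have zW: "z \<in> W" using fh ident_comp[OF fh] ident_in[OF N] by (auto simp: W_def z_def)
  have zo: "ob z = N" "str z = Ident K N" "x \<in> X \<Longrightarrow> gen z x = f x" for x by (simp_all add: z_def ob_def str_def gen_def)
  \<comment> \<open>As the structure arrow of \<open>z\<close> is an identity, the structure arrow
    of \<open>w\<close> is itself an edge from \<open>w\<close> to \<open>z\<close>.\<close>
  have Rz: "(w, str w, z) \<in> R" if w: "w \<in> W" for w
    unfolding R_def using w zW zo Ws[OF w] Wsg[OF w] by simp
  have "\<exists>c t. concrete_cone W ob R c t \<and> (\<forall>c' t'. concrete_cone W ob R c' t' \<longrightarrow>
    (\<exists>!h. h \<in> hom c' c \<and> (\<forall>w\<in>W. t w \<cdot> h = t' w)))"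
  proof (rule limit_of_diagram_with_sink[OF connected_limits Wsmall Wo _ _ _ zW])
    fix w u w' assume "(w, u, w') \<in> R"
    then show "w \<in> W \<and> w' \<in> W \<and> u \<in> hom (ob w) (ob w')" by (simp add: R_def)
  next
    fix w assume w: "w \<in> W"
    have "Ident K (ob w) \<cdot> gen w x = gen w x" if "x \<in> X" for x using Wg[OF w that] by simp
    then show "(w, Ident K (ob w), w) \<in> R"
      using w Wo[OF w] Ws[OF w] by (simp add: R_def ident_in)
  next
    fix w assume "w \<in> W" then show "\<exists>u. (w, u, z) \<in> R" using Rz by blast
  next
    fix w u w' u' w'' assume "(w, u, w') \<in> R" "(w', u', w'') \<in> R"
    then have w: "w \<in> W" "w'' \<in> W" "w' \<in> W" and u: "u \<in> hom (ob w) (ob w')" "\<And>x. x \<in> X \<Longrightarrow> u \<cdot> gen w x = gen w' x" "str w' \<cdot> u = str w"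
      and u': "u' \<in> hom (ob w') (ob w'')" "\<And>x. x \<in> X \<Longrightarrow> u' \<cdot> gen w' x = gen w'' x" "str w'' \<cdot> u' = str w'"
      by (auto simp: R_def)
    have "(u' \<cdot> u) \<cdot> gen w x = gen w'' x" if x: "x \<in> X" for x
      using comp_assoc[OF u'(1) u(1) Wg[OF w(1) x]] u(2) u'(2) x by simp
    moreover have "str w'' \<cdot> (u' \<cdot> u) = str w"
      using comp_assoc[OF Ws[OF w(2)] u'(1) u(1)] u(3) u'(3) by simp
    ultimately show "(w, u' \<cdot> u, w'') \<in> R" using w comp_in[OF u'(1) u(1)] by (simp add: R_def)
  qed
  then obtain L \<pi> where L: "concrete_cone W ob R L \<pi>"
    and uL: "\<And>c' t'. concrete_cone W ob R c' t' \<Longrightarrow> \<exists>!h. h \<in> hom c' L \<and> (\<forall>w\<in>W. \<pi> w \<cdot> h = t' w)" by blast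
  have LO: "L \<in> Obj K" and \<pi>: "\<And>w. w \<in> W \<Longrightarrow> \<pi> w \<in> hom L (ob w)"
    and \<pi>R: "\<And>w u w'. (w, u, w') \<in> R \<Longrightarrow> u \<cdot> \<pi> w = \<pi> w'"
    using L unfolding concrete_cone_def by blast+
  have str_\<pi>: "str w \<cdot> \<pi> w = \<pi> z" if "w \<in> W" for w using \<pi>R[OF Rz[OF that]] .
  define k where "k = \<pi> z"
  have k: "k \<in> hom L N" using \<pi>[OF zW] zo by (simp add: k_def)
  \<comment> \<open>For fixed \<open>x\<close>, the lifts form a cone; its mediating arrow is the
    generator of the hull at \<open>x\<close>.\<close>
  have "\<exists>h\<in>hom (Dom K (f x)) L. \<forall>w\<in>W. \<pi> w \<cdot> h = gen w x" if x: "x \<in> X" for x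
  proof -
    have "concrete_cone W ob R (Dom K (f x)) (\<lambda>w. gen w x)"
      unfolding concrete_cone_def using Wg x fS[OF x] S_obj by (auto simp: R_def)
    from uL[OF this] show ?thesis by (elim ex1E conjE) (rule bexI)
  qed
  then obtain g where g: "\<And>x. x \<in> X \<Longrightarrow> g x \<in> hom (Dom K (f x)) L \<and> (\<forall>w\<in>W. \<pi> w \<cdot> g x = gen w x)" by metis
  have dg: "Dom K (g x) = Dom K (f x)" if "x \<in> X" for x using g[OF that] by (simp add: Hom_def)
  have kg: "k \<cdot> g x = f x" if x: "x \<in> X" for x using g[OF x] zW zo(3)[OF x] by (simp add: k_def)
  have gen: "generated X g L"
    unfolding generated_def
  proof (intro conjI ballI allI impI LO)
    fix x assume x: "x \<in> X"
    show "g x \<in> elements L" using g[OF x] fS[OF x] dg[OF x] by (simp add: elements_iff)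
  next
    fix P m p assume m: "m \<in> hom P L" and "\<forall>x\<in>X. p x \<in> hom (Dom K (g x)) P \<and> m \<cdot> p x = g x"
    then have p: "p x \<in> hom (Dom K (f x)) P" "m \<cdot> p x = g x" if "x \<in> X" for x using dg[OF that] that by auto
    \<comment> \<open>\<open>P\<close> need not occur in the diagram, but a member \<open>A\<close>
      of the solution set lies over it and becomes a vertex \<open>w\<close> by composing down to
      \<open>N\<close>. The leg of the limit at \<open>w\<close>, followed by \<open>a\<close>, is
      the section.\<close>
    obtain A a q where A: "A \<in> \<H>" and a: "a \<in> hom A P"
      and q: "\<And>x. x \<in> X \<Longrightarrow> q x \<in> hom (Dom K (f x)) A \<and> a \<cdot> q x = p x"
      using sol[OF hom_dom[OF m], of p] p(1) by blast
    have ma: "m \<cdot> a \<in> hom A L" and kma: "k \<cdot> (m \<cdot> a) \<in> hom A N" using comp_in m a k by blast+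
    have maq: "(m \<cdot> a) \<cdot> q x = g x" if x: "x \<in> X" for x
      using comp_assoc[OF m a] q[OF x] p(2)[OF x] by metis
    define w where "w = (A, restrict q X, k \<cdot> (m \<cdot> a))"
    have wo: "ob w = A" "str w = k \<cdot> (m \<cdot> a)" "x \<in> X \<Longrightarrow> gen w x = q x" for x
      by (simp_all add: w_def ob_def str_def gen_def)
    have "(k \<cdot> (m \<cdot> a)) \<cdot> q x = f x" if x: "x \<in> X" for x
      using comp_assoc[OF k ma] q[OF x] maq[OF x] kg[OF x] by metis
    then have w: "w \<in> W" unfolding W_def w_def using A q kma by auto
    have \<pi>w: "\<pi> w \<in> hom L A" using \<pi>[OF w] wo by simp
    define s where "s = a \<cdot> \<pi> w"
    have s: "s \<in> hom L P" using comp_in[OF a \<pi>w] by (simp add: s_def)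
    have "m \<cdot> s = Ident K L"
    proof -
      have ms: "m \<cdot> s = (m \<cdot> a) \<cdot> \<pi> w" using comp_assoc[OF m a \<pi>w] by (simp add: s_def)
      \<comment> \<open>The composite of \<open>a\<close>, \<open>m\<close> and the leg at
        \<open>w'\<close> is an edge from \<open>w\<close> to \<open>w'\<close>, so every leg
        absorbs \<open>m \<cdot> s\<close>.\<close>
      have eq: "\<pi> w' \<cdot> (m \<cdot> s) = \<pi> w'" if w': "w' \<in> W" for w'
      proof -
        have "(w, \<pi> w' \<cdot> (m \<cdot> a), w') \<in> R"
        proof -
          have "(\<pi> w' \<cdot> (m \<cdot> a)) \<cdot> gen w x = gen w' x" if x: "x \<in> X" for x
            using comp_assoc[OF \<pi>[OF w'] ma] q[OF x] maq[OF x] wo(3)[OF x] g[OF x] w' by metis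
          moreover have "str w' \<cdot> (\<pi> w' \<cdot> (m \<cdot> a)) = str w"
            using comp_assoc[OF Ws[OF w'] \<pi>[OF w'] ma] str_\<pi>[OF w'] wo(2) by (simp add: k_def)
          moreover have "\<pi> w' \<cdot> (m \<cdot> a) \<in> hom (ob w) (ob w')" using comp_in[OF \<pi>[OF w'] ma] wo(1) by simp
          ultimately show ?thesis using w w' by (simp add: R_def)
        qed
        then have "(\<pi> w' \<cdot> (m \<cdot> a)) \<cdot> \<pi> w = \<pi> w'" by (rule \<pi>R)
        then show ?thesis using comp_assoc[OF \<pi>[OF w'] ma \<pi>w] ms by simp
      qed
      have "\<exists>!h. h \<in> hom L L \<and> (\<forall>w\<in>W. \<pi> w \<cdot> h = \<pi> w)" using uL[OF L] .
      moreover have "m \<cdot> s \<in> hom L L \<and> (\<forall>w\<in>W. \<pi> w \<cdot> (m \<cdot> s) = \<pi> w)" using comp_in[OF m s] eq by blast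
      moreover have "Ident K L \<in> hom L L \<and> (\<forall>w\<in>W. \<pi> w \<cdot> Ident K L = \<pi> w)"
        using ident_in[OF LO] comp_ident[OF \<pi>] by blast
      ultimately show ?thesis by (elim ex1E) blast
    qed
    moreover have "s \<cdot> g x = p x" if x: "x \<in> X" for x
    proof -
      have "s \<cdot> g x = a \<cdot> (\<pi> w \<cdot> g x)" using comp_assoc[OF a \<pi>w] g[OF x] by (metis s_def)
      then show ?thesis using g[OF x] w wo(3)[OF x] q[OF x] by simp
    qed
    ultimately show "\<exists>s\<in>hom L P. m \<cdot> s = Ident K L \<and> (\<forall>x\<in>X. s \<cdot> g x = p x)" using s by blast
  qed
  show thesis
  proof (rule that[OF k gen])
    fix x assume x: "x \<in> X"
    show "g x \<in> hom (Dom K (f x)) L \<and> k \<cdot> g x = f x" using g[OF x] kg[OF x] by simp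
  qed
qed

section \<open>Objects of given size\<close>

text \<open>For small \<open>F\<close>, this is equivalent to \<open>y\<close> lifting to the hull
  of \<open>F\<close> in \<open>N\<close>, as that hull maps over \<open>N\<close> to every such
  \<open>A\<close>. The form chosen refers to no hull and can be tested against a solution
  set.\<close>

definition covered :: "'a \<Rightarrow> 'a set \<Rightarrow> 'a \<Rightarrow> bool" where
  "covered N F y \<longleftrightarrow> (\<forall>A. \<forall>a\<in>hom A N. (\<forall>y'\<in>F. \<exists>z\<in>hom (Dom K y') A. a \<cdot> z = y') \<longrightarrow>
     (\<exists>z\<in>hom (Dom K y) A. a \<cdot> z = y))"

lemma not_coveredE:
  assumes "\<not> covered N F y"
  obtains A a where "a \<in> hom A N" "\<And>y'. y' \<in> F \<Longrightarrow> \<exists>z\<in>hom (Dom K y') A. a \<cdot> z = y'"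
    "\<And>z. z \<in> hom (Dom K y) A \<Longrightarrow> a \<cdot> z \<noteq> y"
  using assms unfolding covered_def by blast

lemma uncovered_sequence:
  fixes r :: "'a rel"
  assumes r: "small_regular r" "\<mu> \<le>o r" and "large K"
  obtains N x where "N \<in> Obj K" "\<And>j. x j \<in> elements N" "\<And>j. \<not> covered N (x ` underS r j) (x j)"
proof -
  let ?B = "Field r" let ?U = "{u \<in> Arr K. Dom K u \<in> S \<and> Cod K u \<in> S}"
  have co: "Card_order r" "infinite ?B" "r <o |UNIV :: 'a set|"
    using r(1) by (auto simp: small_regular_def small_cardinal_def cinfinite_def)
  have Br: "|?B| =o r" using co(1) by (rule card_of_Field_ordIso)
  have B: "is_small ?B" "\<mu> \<le>o |?B|"
    using ordIso_ordLess_trans[OF Br co(3)] ordLeq_ordIso_trans[OF r(2) ordIso_symmetric[OF Br]] .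
  have wf: "wf (r - Id)" using co(1) card_order_on_well_order_on by (auto simp: well_order_on_def)
  have "is_small (Pow ?B \<times> ?U)" by (intro small_Times small_Pow B(1) small_homs is_small_S)
  then obtain N where N: "N \<in> Obj K" "\<not> |elements N| \<le>o |Pow ?B \<times> ?U|"
    using large_unbounded[OF \<open>large K\<close>] by blast
  \<comment> \<open>If \<open>F\<close> covered all elements of \<open>N\<close>, they would all
    lift to one object of a solution set, and \<open>N\<close> would obey the bound it was chosen to
    exceed.\<close>
  have escape: "\<exists>y\<in>elements N. \<not> covered N F y" if F: "F \<subseteq> elements N" "|F| \<le>o |?B|" for F
  proof (rule ccontr)
    assume "\<not> ?thesis"
    then have cov: "\<And>y. y \<in> elements N \<Longrightarrow> covered N F y" by blast
    obtain A a where A: "A \<in> Obj K" "|elements A| \<le>o |Pow ?B \<times> ?U|" "a \<in> hom A N"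
      "\<And>y. y \<in> F \<Longrightarrow> \<exists>z\<in>hom (Dom K y) A. a \<cdot> z = y"
      using solution_set[OF co(2) B(2) N(1) F] by blast
    have "elements N \<subseteq> (\<lambda>z. a \<cdot> z) ` elements A"
    proof
      fix y assume y: "y \<in> elements N"
      then obtain z where z: "z \<in> hom (Dom K y) A" "a \<cdot> z = y"
        using cov[OF y] A(3,4) unfolding covered_def by blast
      then have "z \<in> elements A" using y by (simp add: elements_def Hom_def)
      then show "y \<in> (\<lambda>z. a \<cdot> z) ` elements A" using z(2) by blast
    qed
    then have "|elements N| \<le>o |elements A|" by (rule in_ordLeq_card)
    then show False using N(2) ordLeq_transitive[OF _ A(2)] by blast
  qed
  \<comment> \<open>The recursion runs over the whole type; outside \<open>Field r\<close> the set
    \<open>underS r j\<close> is empty.\<close>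
  have "\<exists>x. \<forall>j. x j \<in> elements N \<and> \<not> covered N (x ` underS r j) (x j)"
  proof (rule dependent_wf_choice[OF wf, of "\<lambda>x j y. y \<in> elements N \<and> \<not> covered N (x ` underS r j) y"])
    fix y j and f g :: "'a \<Rightarrow> 'a" assume "\<And>z. (z, j) \<in> r - Id \<Longrightarrow> f z = g z"
    then have "f ` underS r j = g ` underS r j" by (intro image_cong refl) (simp add: underS_def)
    then show "(y \<in> elements N \<and> \<not> covered N (f ` underS r j) y) = (y \<in> elements N \<and> \<not> covered N (g ` underS r j) y)"
      by simp
  next
    fix j and f :: "'a \<Rightarrow> 'a" assume IH: "\<And>i. (i, j) \<in> r - Id \<Longrightarrow> f i \<in> elements N \<and> \<not> covered N (f ` underS r i) (f i)"
    have "f ` underS r j \<subseteq> elements N" using IH unfolding underS_def by blast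
    moreover have "underS r j \<subseteq> ?B" by (auto simp: underS_def Field_def)
    then have "|f ` underS r j| \<le>o |?B|" using card_of_image card_of_mono1 ordLeq_transitive by blast
    ultimately show "\<exists>y. y \<in> elements N \<and> \<not> covered N (f ` underS r j) y" using escape by blast
  qed
  then show thesis using that N(1) by blast
qed

lemma not_presentable_hull:
  fixes r :: "'a rel"
  assumes r: "small_regular r" "\<mu> \<le>o r" and N: "N \<in> Obj K"
    and x: "\<And>j. x j \<in> elements N" and unc: "\<And>j. \<not> covered N (x ` underS r j) (x j)"
    and H: "generated (Field r) g0 H" and k0: "k0 \<in> hom H N"
    and g0: "\<And>i. i \<in> Field r \<Longrightarrow> g0 i \<in> hom (Dom K (x i)) H \<and> k0 \<cdot> g0 i = x i"
  shows "\<not> presentable K r H"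
proof
  assume pres: "presentable K r H"
  have co: "Card_order r" "infinite (Field r)" "r <o |UNIV :: 'a set|" "regularCard r"
    using r(1) by (auto simp: small_regular_def small_cardinal_def cinfinite_def)
  have Br: "|Field r| =o r" using co(1) by (rule card_of_Field_ordIso)
  have B: "is_small (Field r)" "\<mu> \<le>o |Field r|"
    using ordIso_ordLess_trans[OF Br co(3)] ordLeq_ordIso_trans[OF r(2) ordIso_symmetric[OF Br]] .
  have po: "partial_order_on (Field r) r"
    using co(1) card_order_on_well_order_on by (auto simp: well_order_on_def linear_order_on_def)
  then have trans: "trans r" and antisym: "antisym r" by (auto simp: partial_order_on_def preorder_on_def)
  have FS: "underS r j \<subseteq> Field r" for j by (auto simp: underS_def Field_def)
  have mono: "i' \<in> underS r j" if "(i, j) \<in> r" "i' \<in> underS r i" for i i' j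
    using that transD[OF trans] antisymD[OF antisym] unfolding underS_def by blast
  \<comment> \<open>Stage \<open>j\<close> is the hull of the strict segment below \<open>j\<close>,
    and so omits \<open>x j\<close> from its generating family.\<close>
  have "\<exists>H k g. k \<in> hom H N \<and> generated (underS r j) g H \<and>
      (\<forall>i\<in>underS r j. g i \<in> hom (Dom K (x i)) H \<and> k \<cdot> g i = x i)" for j
  proof -
    have "|underS r j| \<le>o |Field r|" using FS by (rule card_of_mono1)
    then obtain H k g where "k \<in> hom H N" "generated (underS r j) g H"
      "\<And>i. i \<in> underS r j \<Longrightarrow> g i \<in> hom (Dom K (x i)) H \<and> k \<cdot> g i = x i"
      by (rule hull_exists[OF B(1) co(2) B(2) N _ x]) (rule that, assumption+)
    then have "k \<in> hom H N \<and> generated (underS r j) g H \<and>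
      (\<forall>i\<in>underS r j. g i \<in> hom (Dom K (x i)) H \<and> k \<cdot> g i = x i)" by (intro conjI ballI) simp_all
    then show ?thesis by (intro exI)
  qed
  then obtain L k g where k: "\<And>j. k j \<in> hom (L j) N" and L: "\<And>j. generated (underS r j) (g j) (L j)"
    and g: "\<And>j i. i \<in> underS r j \<Longrightarrow> g j i \<in> hom (Dom K (x i)) (L j) \<and> k j \<cdot> g j i = x i" by metis
  have dg: "Dom K (g j i) = Dom K (x i)" if "i \<in> underS r j" for i j using g[OF that] by (simp add: Hom_def)
  have dg0: "Dom K (g0 i) = Dom K (x i)" if "i \<in> Field r" for i using g0[OF that] by (simp add: Hom_def)
  have "\<exists>s\<in>hom (L i) (L j). \<forall>l\<in>underS r i. s \<cdot> g i l = g j l" if ij: "(i, j) \<in> r" for i j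
  proof -
    have "g j l \<in> hom (Dom K (g i l)) (L j) \<and> k j \<cdot> g j l = k i \<cdot> g i l" if l: "l \<in> underS r i" for l
      using g[OF l] g[OF mono[OF ij l]] dg[OF l] by simp
    from generated_extend[OF L k k this] show ?thesis by metis
  qed
  then obtain tr where tr: "\<And>i j. (i, j) \<in> r \<Longrightarrow> tr i j \<in> hom (L i) (L j)"
    and trg: "\<And>i j l. (i, j) \<in> r \<Longrightarrow> l \<in> underS r i \<Longrightarrow> tr i j \<cdot> g i l = g j l" by metis
  define D :: "('a, 'a \<times> 'a, 'a, 'a) func" where "D = \<lparr> ob_map = L, ar_map = (\<lambda>(i, j). tr i j) \<rparr>"
  have LO: "L i \<in> Obj K" for i using generated_obj[OF L] .
  have D: "is_functor (poset_cat (Field r) r) K D"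
    unfolding functor_poset_iff[OF po] D_def
  proof (simp only: func.simps prod.case, intro conjI allI impI ballI LO)
    fix i assume i: "i \<in> Field r"
    have ii: "(i, i) \<in> r" using po i by (simp add: partial_order_on_def preorder_on_def refl_on_def)
    show "tr i i = Ident K (L i)"
    proof (rule generated_unique[OF L tr[OF ii] ident_in[OF LO]])
      fix l assume l: "l \<in> underS r i"
      show "tr i i \<cdot> g i l = Ident K (L i) \<cdot> g i l"
        using trg[OF ii l] ident_comp[OF generated_hom[OF L l]] by simp
    qed
  next
    fix i j assume "(i, j) \<in> r" then show "tr i j \<in> hom (L i) (L j)" by (rule tr)
  next
    fix i j l assume ij: "(i, j) \<in> r" and jl: "(j, l) \<in> r"
    have il: "(i, l) \<in> r" using transD[OF trans ij jl] .
    show "tr i l = tr j l \<cdot> tr i j"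
    proof (rule generated_unique[OF L tr[OF il] comp_in[OF tr[OF jl] tr[OF ij]]])
      fix y assume y: "y \<in> underS r i"
      show "tr i l \<cdot> g i y = (tr j l \<cdot> tr i j) \<cdot> g i y"
        using comp_assoc[OF tr[OF jl] tr[OF ij] generated_hom[OF L y]] trg[OF ij y] trg[OF il y]
          trg[OF jl mono[OF ij y]] by simp
    qed
  qed
  have dir: "directed_poset r (Field r) r"
    unfolding directed_poset_def
  proof (intro conjI allI impI po)
    show "small (Field r)" using B(1) by (simp add: small_def)
    fix Z assume "Z \<subseteq> Field r" "|Z| <o r"
    then obtain b where "b \<in> Field r" "Z \<subseteq> underS r b"
      using regular_strict_upper_bound[OF co(1,2,4)] by blast
    then show "\<exists>b\<in>Field r. \<forall>s\<in>Z. (s, b) \<in> r" unfolding underS_def by blast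
  qed
  obtain c t where col: "is_colimit (poset_cat (Field r) r) K D c t"
    using directed_colimits D directed_mono[OF dir r(2)] unfolding has_directed_colimits_def by blast
  have "\<forall>j\<in>Field r. t j \<in> hom (ob_map D j) c"
    using col unfolding colimit_poset_iff cocone_poset_iff by blast
  then have t: "t j \<in> hom (L j) c" if "j \<in> Field r" for j using that by (simp add: D_def)
  have "\<exists>s\<in>hom (L j) H. k0 \<cdot> s = k j \<and> (\<forall>l\<in>underS r j. s \<cdot> g j l = g0 l)" for j
  proof -
    have "g0 l \<in> hom (Dom K (g j l)) H \<and> k0 \<cdot> g0 l = k j \<cdot> g j l" if l: "l \<in> underS r j" for l
      using g[OF l] g0[OF subsetD[OF FS l]] dg[OF l] by simp
    from generated_extend[OF L k k0 this] show ?thesis by metis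
  qed
  then obtain e where e: "\<And>j. e j \<in> hom (L j) H" "\<And>j. k0 \<cdot> e j = k j"
    and eg: "\<And>j l. l \<in> underS r j \<Longrightarrow> e j \<cdot> g j l = g0 l" by metis
  have HO: "H \<in> Obj K" using H by (rule generated_obj)
  have "is_cocone (poset_cat (Field r) r) K D H e"
    unfolding cocone_poset_iff D_def
  proof (simp only: func.simps prod.case, intro conjI ballI allI impI HO e)
    fix i j assume ij: "(i, j) \<in> r"
    show "e j \<cdot> tr i j = e i"
    proof (rule generated_unique[OF L comp_in[OF e(1) tr[OF ij]] e(1)])
      fix l assume l: "l \<in> underS r i"
      show "(e j \<cdot> tr i j) \<cdot> g i l = e i \<cdot> g i l"
        using comp_assoc[OF e(1) tr[OF ij] generated_hom[OF L l]] trg[OF ij l] eg[OF mono[OF ij l]] eg[OF l] by simp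
    qed
  qed
  then obtain h where h: "h \<in> hom c H" "\<And>j. j \<in> Field r \<Longrightarrow> h \<cdot> t j = e j" using colimit_obtain[OF col] by blast
  \<comment> \<open>The order \<open>r\<close> has no last element, so each generator belongs to a
    later strict segment and lifts to the colimit. This makes \<open>H\<close> a retract of
    \<open>c\<close>.\<close>
  have "\<exists>p\<in>hom (Dom K (g0 i)) c. h \<cdot> p = g0 i" if i: "i \<in> Field r" for i
  proof -
    obtain j where j: "j \<in> Field r" "i \<noteq> j" "(i, j) \<in> r"
      using infinite_Card_order_limit[OF co(1,2) i] by (elim bexE conjE)
    then have ij: "i \<in> underS r j" by (simp add: underS_def)
    have gi: "g j i \<in> hom (Dom K (g0 i)) (L j)" using g[OF ij] dg0[OF i] by simp
    have "h \<cdot> (t j \<cdot> g j i) = g0 i" using comp_assoc[OF h(1) t[OF j(1)] gi] h(2)[OF j(1)] eg[OF ij] by simp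
    then show ?thesis using comp_in[OF t[OF j(1)] gi] by blast
  qed
  then obtain p where p: "\<And>i. i \<in> Field r \<Longrightarrow> p i \<in> hom (Dom K (g0 i)) c \<and> h \<cdot> p i = g0 i" by metis
  obtain s where s: "s \<in> hom H c" "h \<cdot> s = Ident K H" using generated_section[OF H h(1) p] by blast
  have "compact_at (Field r) r D c t H" using pres presentable_iff[OF r(1)] dir D col by blast
  then obtain j q where j: "j \<in> Field r" and q': "q \<in> hom H (ob_map D j)" "t j \<cdot> q = s"
    using s(1) unfolding compact_at_def by blast
  then have q: "q \<in> hom H (L j)" "t j \<cdot> q = s" by (simp_all add: D_def)
  \<comment> \<open>A section of \<open>h\<close> that factors through stage \<open>j\<close> splits
    \<open>e j\<close>; hence \<open>q\<close> carries the generator \<open>g0 j\<close> to an arrow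
    into \<open>L j\<close> lying over \<open>x j\<close>.\<close>
  have eq: "e j \<cdot> q = Ident K H" using comp_assoc[OF h(1) t[OF j] q(1)] h(2)[OF j] q(2) s(2) by simp
  have gj: "g0 j \<in> hom (Dom K (x j)) H" using g0[OF j] by simp
  have qg: "q \<cdot> g0 j \<in> hom (Dom K (x j)) (L j)" using comp_in[OF q(1) gj] .
  have "k j \<cdot> (q \<cdot> g0 j) = k0 \<cdot> (e j \<cdot> (q \<cdot> g0 j))" using comp_assoc[OF k0 e(1) qg] e(2) by simp
  also have "e j \<cdot> (q \<cdot> g0 j) = g0 j" using comp_assoc[OF e(1) q(1) gj] eq gj by simp
  finally have xj: "k j \<cdot> (q \<cdot> g0 j) = x j" using g0[OF j] by simp
  \<comment> \<open>The object that witnesses that \<open>x j\<close> is uncovered receives an arrow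
    over \<open>N\<close> from the hull \<open>L j\<close>, and with it a lift of
    \<open>x j\<close>.\<close>
  obtain A a where a: "a \<in> hom A N" and al: "\<And>y. y \<in> x ` underS r j \<Longrightarrow> \<exists>z\<in>hom (Dom K y) A. a \<cdot> z = y"
    and no: "\<And>z. z \<in> hom (Dom K (x j)) A \<Longrightarrow> a \<cdot> z \<noteq> x j"
    by (rule not_coveredE[OF unc[of j]]) (rule that, assumption+)
  have "\<exists>z\<in>hom (Dom K (x i)) A. a \<cdot> z = x i" if "i \<in> underS r j" for i using al that by blast
  then obtain z where z: "\<And>i. i \<in> underS r j \<Longrightarrow> z i \<in> hom (Dom K (x i)) A \<and> a \<cdot> z i = x i" by metis
  have "z i \<in> hom (Dom K (g j i)) A \<and> a \<cdot> z i = k j \<cdot> g j i" if i: "i \<in> underS r j" for i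
    using z[OF i] g[OF i] dg[OF i] by simp
  then obtain s' where s': "s' \<in> hom (L j) A" "a \<cdot> s' = k j" using generated_extend[OF L k a, of j z] by blast
  have "a \<cdot> (s' \<cdot> (q \<cdot> g0 j)) = x j" using comp_assoc[OF a s'(1) qg] s'(2) xj by simp
  then show False using no[OF comp_in[OF s'(1) qg]] by blast
qed

text \<open>A hull of \<open>|Field r|\<close> elements is presentable at the successor of
  \<open>r\<close>. A smaller regular cardinal is at most \<open>r\<close>, and presentability there
  would pass up to \<open>r\<close>. So the rank is the successor of \<open>r\<close>, and the first
  alternative in \<open>is_internal_size\<close> applies.\<close>

lemma internal_size_exists:
  fixes r :: "'a rel"
  assumes r: "small_regular r" "\<mu> \<le>o r" and "large K"
  shows "\<exists>M\<in>Obj K. is_internal_size K M r"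
proof -
  obtain N x where N: "N \<in> Obj K" and x: "\<And>j. x j \<in> elements N"
    and unc: "\<And>j. \<not> covered N (x ` underS r j) (x j)"
    using uncovered_sequence[OF assms] by blast
  have co: "Card_order r" "infinite (Field r)" "r <o |UNIV :: 'a set|" "small_cardinal r"
    using r(1) by (auto simp: small_regular_def small_cardinal_def cinfinite_def)
  have Br: "|Field r| =o r" using co(1) by (rule card_of_Field_ordIso)
  have B: "is_small (Field r)" "\<mu> \<le>o |Field r|"
    using ordIso_ordLess_trans[OF Br co(3)] ordLeq_ordIso_trans[OF r(2) ordIso_symmetric[OF Br]] .
  have BB: "|Field r| \<le>o |Field r|" by (rule card_of_mono1) simp
  obtain H k g where H: "k \<in> hom H N" "generated (Field r) g H"
    "\<And>i. i \<in> Field r \<Longrightarrow> g i \<in> hom (Dom K (x i)) H \<and> k \<cdot> g i = x i"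
    by (rule hull_exists[OF B(1) co(2) B(2) N BB x]) (rule that, assumption+)
  have not: "\<not> presentable K r H" by (rule not_presentable_hull[OF r N x unc H(2,1,3)])
  obtain \<rho> :: "'a rel" where \<rho>: "small_regular \<rho>" "\<rho> =o cardSuc r"
    using small_regular_cardSuc[OF r(1)] by blast
  have r\<rho>: "r <o \<rho>" using ordLess_ordIso_trans[OF cardSuc_greater[OF co(1)] ordIso_symmetric[OF \<rho>(2)]] .
  have "presentable K \<rho> H"
    by (rule generated_presentable[OF H(2) \<rho>(1) ordLeq_transitive[OF r(2) ordLess_imp_ordLeq[OF r\<rho>]]
          ordIso_ordLess_trans[OF Br r\<rho>]])
  moreover have "\<rho> \<le>o \<sigma>" if \<sigma>: "small_regular \<sigma>" "presentable K \<sigma> H" for \<sigma> :: "'a rel"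
  proof (rule ccontr)
    assume n: "\<not> \<rho> \<le>o \<sigma>"
    have c: "Card_order \<sigma>" "Card_order \<rho>"
      using \<sigma>(1) \<rho>(1) by (auto simp: small_regular_def small_cardinal_def)
    have "\<sigma> <o \<rho>"
      using n not_ordLeq_iff_ordLess[OF card_order_on_well_order_on[OF c(1)] card_order_on_well_order_on[OF c(2)]]
      by blast
    then have "\<sigma> <o cardSuc r" using \<rho>(2) by (rule ordLess_ordIso_trans)
    then have "\<sigma> \<le>o r" using cardSuc_ordLeq_ordLess[OF co(1) c(1)] by blast
    then show False using presentable_mono[OF \<sigma>(1) r(1) _ \<sigma>(2)] not by blast
  qed
  ultimately have "is_internal_size K H r"
    unfolding is_internal_size_def is_presentability_rank_def using \<rho> co(4) by blast
  then show ?thesis using generated_obj[OF H(2)] by blast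
qed

end

theorem theoremA2:
  fixes K :: "('v, 'v) cat"
  assumes "strongly_inaccessible |UNIV :: 'v set|"
    and "large K"
    and "locally_multipresentable K"
  shows "weakly_LS_accessible K"
proof -
  have K: "category K" "locally_small K" "has_connected_limits K"
    using assms(3) by (auto simp: locally_multipresentable_def accessible_def)
  obtain \<mu> :: "'v rel" where mu: "small_regular \<mu>" "accessible_at K \<mu>"
    using assms(3) unfolding locally_multipresentable_def accessible_def by blast
  interpret small_hom_category K
    by unfold_locales (use assms(1) K in auto)
  obtain S0 where S0: "small S0" "\<And>M. presentable K \<mu> M \<Longrightarrow> \<exists>N\<in>S0. isomorphic K M N"
    using mu(2) unfolding accessible_at_def by blast
  \<comment> \<open>The given \<open>S0\<close> may contain objects that are not presentable.
    Keeping those isomorphic to a presentable object, and exchanging each for such an object, yields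
    representatives that are presentable by choice.\<close>
  define Q where "Q = {N \<in> S0. \<exists>M. presentable K \<mu> M \<and> isomorphic K M N}"
  define rep where "rep N = (SOME M. presentable K \<mu> M \<and> isomorphic K M N)" for N
  have rep: "presentable K \<mu> (rep N) \<and> isomorphic K (rep N) N" if "N \<in> Q" for N
    unfolding rep_def by (rule someI_ex) (use that in \<open>simp add: Q_def\<close>)
  interpret multipresentable_category K \<mu> "rep ` Q"
  proof
    show "small (rep ` Q)"
      using S0(1) small_image[OF small_subset[of S0 Q], of rep] by (auto simp: small_def Q_def)
    show "presentable K \<mu> N" if "N \<in> rep ` Q" for N using that rep by blast
    show "\<exists>N\<in>rep ` Q. isomorphic K M N" if M: "presentable K \<mu> M" for M
    proof -
      obtain N where N: "N \<in> S0" "isomorphic K M N" using S0(2) M by blast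
      then have NQ: "N \<in> Q" using M unfolding Q_def by blast
      have "isomorphic K M (rep N)"
        using isomorphic_trans[OF N(2) isomorphic_sym] rep[OF NQ] by blast
      then show ?thesis using NQ by blast
    qed
    show "small_regular \<mu>" "has_directed_colimits K \<mu>" "has_connected_limits K"
      using mu K by (simp_all add: accessible_at_def)
    show "\<exists>I le D t. directed_poset \<mu> I le \<and> is_functor (poset_cat I le) K D \<and>
        (\<forall>i\<in>I. presentable K \<mu> (ob_map D i)) \<and> is_colimit (poset_cat I le) K D M t"
      if "M \<in> Obj K" for M
      using conjunct2[OF conjunct2[OF mu(2)[unfolded accessible_at_def]]] that by (rule bspec)
  qed
  show ?thesis
    unfolding weakly_LS_accessible_def
  \<comment> \<open>The threshold is the index of accessibility.\<close>
  proof (intro exI[of _ \<mu>] conjI allI impI)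
    show "small_cardinal \<mu>" using mu(1) by (simp add: small_regular_def)
    fix \<mu>' :: "'v rel" assume \<mu>': "small_regular \<mu>' \<and> \<mu> \<le>o \<mu>'"
    show "\<exists>M\<in>Obj K. is_internal_size K M \<mu>'"
      by (rule internal_size_exists[OF conjunct1[OF \<mu>'] conjunct2[OF \<mu>'] assms(2)])
  qed
qed

end
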